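(* Let $j>0$ and let $\rho_{\rm init}\in\mathcal M$, i.e. $\rho_{\rm init}=\rho^{(M)}$ for some $M\ge 0$. Then the hydrodynamic limit $\rho_t$ started from $\rho_{\rm init}$ satisfies $\rho_t=\rho_{\rm init}$ for all $t\ge 0$.
   Context: Particle system: fix $j>0$. For $\varepsilon>0$ with $\varepsilon^{-1}$ a positive integer let $\Lambda_\varepsilon=\{0,1,\dots,\varepsilon^{-1}\}$; configurations are $\xi\in\mathbb N^{\Lambda_\varepsilon}$, $\xi(x)$ being the number of particles at $x$. The process $(\xi_t)_{t\ge0}$ is the Markov jump process with generator $L=L^0+L_b+L_a$, where $L^0f(\xi)=\frac12\sum_{x=0}^{\varepsilon^{-1}-1}[\xi(x)(f(\xi^{x,x+1})-f(\xi))+\xi(x+1)(f(\xi^{x+1,x})-f(\xi))]$ ($\xi^{x,y}$ is obtained by moving one particle from $x$ to $y$), $L_bf(\xi)=j\varepsilon(f(\xi^+)-f(\xi))$ with $\xi^+(x)=\xi(x)+\mathbf 1_{x=0}$, and $L_af(\xi)=j\varepsilon(f(\xi^-)-f(\xi))$ with $\xi^-(x)=\xi(x)-\mathbf 1_{x=R_\xi}$, $R_\xi=\max\{y:\xi(y)>0\}$ ($L_af=0$ if $\xi\equiv0$). $P^{(\varepsilon)}_\xi$ denotes the law of the process started from $\xi$. Notation: $F(r;u)=\int_r^1u(r')dr'$ for $r\in[0,1]$, and $F_\varepsilon(x;\xi)=\sum_{y\ge x}\xi(y)$. For an integer $\ell$ and $x\in[0,\varepsilon^{-1}-\ell+1]$: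 $\mathcal A_\ell(x,\xi)=\frac1\ell\sum_{y=x}^{x+\ell-1}\xi(y)$, $\mathcal A'_\ell(x,\rho)=\frac1{\varepsilon\ell}\int_{\varepsilon x}^{\varepsilon(x+\ell)}\rho(r)dr$. Admissible initial data: $\rho_{\rm init}\in C([0,1],\mathbb R_+)$; its edge (if it exists) is $R(0)=\min\{r:\rho_{\rm init}(r')=0\ \forall r'\in[r,1]\}$. Fix $b<1$ close to $1$ and $a>0$ small, $\ell=\lfloor\varepsilon^{-b}\rfloor$. A family of configurations $\xi=\xi^{(\varepsilon)}$ approximates $\rho_{\rm init}$ if $\max_{x\in[0,\varepsilon^{-1}-\ell+1]}|\mathcal A_\ell(x,\xi)-\mathcal A'_\ell(x,\rho_{\rm init})|\le\varepsilon^a$ and, when $\rho_{\rm init}$ has an edge, $|\varepsilon R_\xi-R(0)|\le\varepsilon^a$. Hydrodynamic limit (known from earlier work): for such $\rho_{\rm init}$ there is a function $\rho_t(r)\ge0$, continuous in $(t,r)$, with $\rho_0=\rho_{\rm init}$, such that for every approximating family $\xi$, every $T>0$, $\zeta>0$, $t\in[0,T]$: $\lim_{\varepsilon\to0}P^{(\varepsilon)}_\xi[\max_{x\in[0,\varepsilon^{-1}]}|\varepsilon F_\varepsilon(x;\xi_{\varepsilon^{-2}t})-F(\varepsilon x;\rho_t)|\le\zeta]=1$. This $\rho_t$ is "the hydrodynamic limit started from $\rho_{\rm init}$". Linear profiles: $\mathcal M=\{\rho^{(M)}:M\ge0\}$ where $\rho^{(0)}\equiv0$; for $0<M<j$, $\rho^{(M)}(r)=2j(R-r)\mathbf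 1_{r\le R}$ with $R\in(0,1)$ chosen so that $\int_0^1\rho^{(M)}=M$ (i.e. $jR^2=M$); for $M\ge j$, $\rho^{(M)}(r)=-2jr+c$ with $c\ge2j$ chosen so that $\int_0^1\rho^{(M)}=M$ (i.e. $c=M+j$). *)

theory Defs
  imports "HOL-Analysis.Analysis"
begin

text \<open>Scale parameter: \<epsilon> = 1/N with N = \<epsilon>^{-1} a positive integer.
  Sites \<Lambda>_\<epsilon> = {0..N}.  A configuration is a function nat \<Rightarrow> nat which
  vanishes outside {0..N}.\<close>

definition is_config :: "nat \<Rightarrow> (nat \<Rightarrow> nat) \<Rightarrow> bool" where
  "is_config N \<xi> \<longleftrightarrow> (\<forall>x>N. \<xi> x = 0)"

text \<open>Rightmost occupied site R_\<xi> (set to 0 for the empty configuration, where it is unused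
  by the dynamics).\<close>
definition rightmost :: "nat \<Rightarrow> (nat \<Rightarrow> nat) \<Rightarrow> nat" where
  "rightmost N \<xi> = (if \<exists>y\<le>N. 0 < \<xi> y then Max {y. y \<le> N \<and> 0 < \<xi> y} else 0)"

definition move :: "(nat \<Rightarrow> nat) \<Rightarrow> nat \<Rightarrow> nat \<Rightarrow> (nat \<Rightarrow> nat)" where
  "move \<xi> x y = \<xi>(x := \<xi> x - 1, y := \<xi> y + 1)"

text \<open>The transitions of the generator L = L^0 + L_b + L_a as a list of (rate, target).\<close>
definition transitions :: "real \<Rightarrow> nat \<Rightarrow> (nat \<Rightarrow> nat) \<Rightarrow> (real \<times> (nat \<Rightarrow> nat)) list" where
  "transitions j N \<xi> =
     map (\<lambda>x. (real (\<xi> x) / 2, move \<xi> x (Suc x))) [0..<N]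
   @ map (\<lambda>x. (real (\<xi> (Suc x)) / 2, move \<xi> (Suc x) x)) [0..<N]
   @ [(j / real N, \<xi>(0 := Suc (\<xi> 0)))]
   @ (if (\<forall>y\<le>N. \<xi> y = 0) then []
      else [(j / real N, \<xi>(rightmost N \<xi> := \<xi> (rightmost N \<xi>) - 1))])"

definition exit_rate :: "real \<Rightarrow> nat \<Rightarrow> (nat \<Rightarrow> nat) \<Rightarrow> real" where
  "exit_rate j N \<xi> = sum_list (map fst (transitions j N \<xi>))"

text \<open>Contribution of trajectories with exactly n jumps to the transition probability
  (backward Kolmogorov / Dyson expansion of the minimal Markov jump process).\<close>
primrec pjumps :: "real \<Rightarrow> nat \<Rightarrow> nat \<Rightarrow> real \<Rightarrow> (nat \<Rightarrow> nat) \<Rightarrow> (nat \<Rightarrow> nat) \<Rightarrow> real" where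
  "pjumps j N 0 s \<xi> \<eta> = (if \<xi> = \<eta> then exp (- exit_rate j N \<xi> * s) else 0)"
| "pjumps j N (Suc n) s \<xi> \<eta> =
     integral {0..s} (\<lambda>u. exp (- exit_rate j N \<xi> * u) *
        sum_list (map (\<lambda>(r, \<zeta>). r * pjumps j N n (s - u) \<zeta> \<eta>) (transitions j N \<xi>)))"

definition ptrans :: "real \<Rightarrow> nat \<Rightarrow> real \<Rightarrow> (nat \<Rightarrow> nat) \<Rightarrow> (nat \<Rightarrow> nat) \<Rightarrow> real" where
  "ptrans j N s \<xi> \<eta> = (\<Sum>n. pjumps j N n s \<xi> \<eta>)"

definition prob_at :: "real \<Rightarrow> nat \<Rightarrow> (nat \<Rightarrow> nat) \<Rightarrow> real \<Rightarrow> ((nat \<Rightarrow> nat) \<Rightarrow> bool) \<Rightarrow> real" where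
  "prob_at j N \<xi> s E = infsum (\<lambda>\<eta>. ptrans j N s \<xi> \<eta>) {\<eta>. is_config N \<eta> \<and> E \<eta>}"

definition blockavg :: "nat \<Rightarrow> nat \<Rightarrow> (nat \<Rightarrow> nat) \<Rightarrow> real" where
  "blockavg l x \<xi> = (\<Sum>y\<in>{x..<x+l}. real (\<xi> y)) / real l"

definition blockint :: "nat \<Rightarrow> nat \<Rightarrow> nat \<Rightarrow> (real \<Rightarrow> real) \<Rightarrow> real" where
  "blockint N l x \<rho> = real N / real l * integral {real x / real N .. real (x + l) / real N} \<rho>"

definition has_edge :: "(real \<Rightarrow> real) \<Rightarrow> bool" where
  "has_edge \<rho> \<longleftrightarrow> {r\<in>{0..1}. \<forall>r'\<in>{r..1}. \<rho> r' = 0} \<noteq> {}"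

definition edge :: "(real \<Rightarrow> real) \<Rightarrow> real" where
  "edge \<rho> = Inf {r\<in>{0..1}. \<forall>r'\<in>{r..1}. \<rho> r' = 0}"

definition approximates :: "real \<Rightarrow> real \<Rightarrow> (real \<Rightarrow> real) \<Rightarrow> (nat \<Rightarrow> nat \<Rightarrow> nat) \<Rightarrow> bool" where
  "approximates a b \<rho>init \<xi> \<longleftrightarrow>
     (\<forall>N. is_config N (\<xi> N)) \<and>
     (\<forall>\<^sub>F N in sequentially.
        (let l = nat \<lfloor>real N powr b\<rfloor> in
          (\<forall>x. x + l \<le> N + 1 \<longrightarrow>
               \<bar>blockavg l x (\<xi> N) - blockint N l x \<rho>init\<bar> \<le> (1 / real N) powr a))
        \<and> (has_edge \<rho>init \<longrightarrow>
             \<bar>real (rightmost N (\<xi> N)) / real N - edge \<rho>init\<bar> \<le> (1 / real N) powr a))"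

definition hydro_limit :: "real \<Rightarrow> real \<Rightarrow> real \<Rightarrow> (real \<Rightarrow> real) \<Rightarrow> (real \<Rightarrow> real \<Rightarrow> real) \<Rightarrow> bool" where
  "hydro_limit j a b \<rho>init \<rho> \<longleftrightarrow>
     continuous_on ({0..} \<times> {0..1}) (\<lambda>(t, r). \<rho> t r) \<and>
     (\<forall>t\<ge>0. \<forall>r\<in>{0..1}. 0 \<le> \<rho> t r) \<and>
     (\<forall>r\<in>{0..1}. \<rho> 0 r = \<rho>init r) \<and>
     (\<forall>\<xi>. approximates a b \<rho>init \<xi> \<longrightarrow>
        (\<forall>t\<ge>0. \<forall>\<zeta>>0.
          ((\<lambda>N. prob_at j N (\<xi> N) (real N ^ 2 * t)
                 (\<lambda>\<eta>. \<forall>x\<le>N. \<bar>(\<Sum>y\<in>{x..N}. real (\<eta> y)) / real N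
                               - integral {real x / real N .. 1} (\<rho> t)\<bar> \<le> \<zeta>))
           \<longlongrightarrow> 1) sequentially))"

definition rhoM :: "real \<Rightarrow> real \<Rightarrow> real \<Rightarrow> real" where
  "rhoM j M r =
     (if M = 0 then 0
      else if M < j then (if r \<le> sqrt (M / j) then 2 * j * (sqrt (M / j) - r) else 0)
      else - 2 * j * r + (M + j))"

end

theory Submission
  imports Defs "HOL-Real_Asymp.Real_Asymp"
begin

text \<open>In terms of the tail sums \<open>F x = (\<Sum>y\<ge>x. \<xi> y)\<close> the hydrodynamic equation is
  \<open>\<partial>\<^sub>t F = F'' / 2 - j 1(F > 0)\<close> with \<open>F\<close> prescribed at both ends, which is monotone in \<open>F\<close> and
  hence contracts the squared distance to its stationary solution \<open>G\<close>, the tail mass of the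
  linear profile. The contraction holds already for the particles: the generator, applied to the
  squared norm of \<open>F - G\<close>, gives a nonpositive term plus noise. The noise of the bulk jumps has
  the critical order, so \<open>F - G\<close> is first smoothed by \<open>n\<close> steps of the simple random walk killed at
  the boundary; this multiplies the noise by a return probability, which vanishes as \<open>n\<close> grows,
  while the smoothing disturbs the monotone term only by \<open>O(n)\<close>. The fluctuation of the total
  mass \<open>F 0\<close> is removed by subtracting a linear function (the bridge), and its square is added with
  a weight of order \<open>N powr (3/2)\<close>. The outcome is a nonnegative \<open>h\<close> with \<open>L h \<le> h / N\<^sup>2\<close>, whose
  expectation grows at most by the factor \<open>exp t\<close> until time \<open>N\<^sup>2 t\<close>. If \<open>\<rho>\<^sub>t\<close> differed from the linear
  profile, \<open>h\<close> would be of order \<open>N\<^sup>3\<close> on the event of the hydrodynamic limit, contradicting Markov's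
  inequality.\<close>

subsection \<open>Lyapunov functions of the minimal jump process\<close>

lemma integral_convolution_reflect:
  fixes k g :: "real \<Rightarrow> real"
  shows "integral {0..s} (\<lambda>u. k u * g (s - u)) = integral {0..s} (\<lambda>v. k (s - v) * g v)"
proof -
  have "integral {0..s} (\<lambda>u. k u * g (s - u)) = integral {-s..-0} (\<lambda>v. k (- v) * g (s - (- v)))"
    by (rule Henstock_Kurzweil_Integration.integral_reflect_real[symmetric])
  also have "\<dots> = integral {0..s} (\<lambda>v. k (s - v) * g v)"
    using integral_shift_Icc_real[of "-s" "-0" "\<lambda>v. k (s - v) * g v" s] by (simp add: o_def)
  finally show ?thesis .
qed

text \<open>After reflection the factor \<open>exp (- q * s)\<close> leaves the integral and an
  indefinite integral remains. This continuity in time makes the integrals of the Dyson expansion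
  meaningful.\<close>

lemma continuous_on_exp_convolution:
  fixes g :: "real \<Rightarrow> real"
  assumes "continuous_on {0..} g"
  shows "continuous_on {0..} (\<lambda>s. integral {0..s} (\<lambda>u. exp (- q * u) * g (s - u)))"
proof -
  have eq: "integral {0..s} (\<lambda>u. exp (- q * u) * g (s - u))
      = exp (- q * s) * integral {0..s} (\<lambda>v. exp (q * v) * g v)" for s
    unfolding integral_convolution_reflect[of s "\<lambda>u. exp (- q * u)" g] integral_mult_right[symmetric]
    by (intro arg_cong[where f = "integral _"] ext) (simp add: algebra_simps exp_diff exp_minus divide_inverse)
  have cont: "continuous_on {0..} (\<lambda>v. exp (q * v) * g v)"
    by (intro continuous_intros assms)
  have "continuous_on {0..} (\<lambda>s. integral {0..s} (\<lambda>v. exp (q * v) * g v))"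
    unfolding continuous_on_eq_continuous_within
  proof
    fix s :: real assume s: "s \<in> {0..}"
    have "continuous_on {0..s+1} (\<lambda>s. integral {0..s} (\<lambda>v. exp (q * v) * g v))"
      by (intro indefinite_integral_continuous_1 integrable_continuous_interval continuous_on_subset[OF cont]) auto
    hence "continuous (at s within {0..s+1}) (\<lambda>s. integral {0..s} (\<lambda>v. exp (q * v) * g v))"
      using s by (auto simp: continuous_on_eq_continuous_within)
    moreover have "at s within {0..s+1} = at s within {0..}"
      by (rule at_within_nhd[of _ "{..<s+1}"]) auto
    ultimately show "continuous (at s within {0..}) (\<lambda>s. integral {0..s} (\<lambda>v. exp (q * v) * g v))"
      by simp
  qed
  thus ?thesis unfolding eq by (intro continuous_intros)
qed

lemma continuous_on_sum_list:
  fixes f :: "'i \<Rightarrow> 'a::topological_space \<Rightarrow> 'b::topological_monoid_add"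
  assumes "\<And>i. i \<in> set xs \<Longrightarrow> continuous_on A (f i)"
  shows "continuous_on A (\<lambda>x. sum_list (map (\<lambda>i. f i x) xs))"
  using assms by (induction xs) (auto intro!: continuous_intros)

lemma continuous_on_pjumps: "continuous_on {0..} (\<lambda>s. pjumps j N n s \<xi> \<eta>)"
proof (induction n arbitrary: \<xi>)
  case (Suc n)
  show ?case unfolding pjumps.simps
    by (rule continuous_on_exp_convolution)
       (auto intro!: continuous_on_sum_list continuous_intros Suc simp: case_prod_unfold)
next
  case 0
  show ?case by (cases "\<xi> = \<eta>") (auto intro!: continuous_intros)
qed

lemma transitions_rate_nonneg:
  assumes "0 \<le> j" "(r, \<zeta>) \<in> set (transitions j N \<xi>)"
  shows "0 \<le> r"
  using assms by (auto simp: transitions_def split: if_splits)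

lemma transitions_is_config:
  assumes "is_config N \<xi>" "(r, \<zeta>) \<in> set (transitions j N \<xi>)"
  shows "is_config N \<zeta>"
  using assms by (auto simp: transitions_def is_config_def move_def split: if_splits)

lemma pjumps_nonneg:
  assumes "0 \<le> j"
  shows "0 \<le> s \<Longrightarrow> 0 \<le> pjumps j N n s \<xi> \<eta>"
proof (induction n arbitrary: s \<xi>)
  case (Suc n)
  show ?case unfolding pjumps.simps
    using Suc transitions_rate_nonneg[OF assms]
    by (intro integral_nonneg integrable_continuous_interval)
       (auto intro!: continuous_on_sum_list continuous_intros  sum_list_nonneg mult_nonneg_nonneg
           continuous_on_compose2[OF continuous_on_pjumps]
         simp: case_prod_unfold)
qed auto

lemma sum_sum_list: "(\<Sum>k\<in>A. sum_list (map (f k) xs)) = sum_list (map (\<lambda>i. \<Sum>k\<in>A. f k i) xs)"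
  for f :: "'k \<Rightarrow> 'i \<Rightarrow> 'a::comm_monoid_add"
  by (induction xs) (auto simp: sum.distrib)

text \<open>Hypothesis \<open>gen\<close> is \<open>L h \<le> \<mu> h\<close> with the exit rate
  moved to the right. Conditioning on the first jump and using the induction hypothesis, the paths
  with at least one jump contribute at most
  \<open>exp (\<mu> * s) * h \<xi> - exp (- q * s) * h \<xi>\<close>, and the path without jumps at
  most the subtracted term. Truncation at \<open>n\<close> jumps and the finite set \<open>T\<close>
  keep all sums finite.\<close>

lemma pjumps_lyapunov:
  assumes j: "0 \<le> j" and mu: "0 < \<mu>" and T: "finite T"
    and h: "\<And>\<xi>. is_config N \<xi> \<Longrightarrow> 0 \<le> h \<xi>"
    and gen: "\<And>\<xi>. is_config N \<xi> \<Longrightarrow>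
      sum_list (map (\<lambda>(r, \<zeta>). r * h \<zeta>) (transitions j N \<xi>)) \<le> (\<mu> + exit_rate j N \<xi>) * h \<xi>"
  shows "0 \<le> s \<Longrightarrow> is_config N \<xi> \<Longrightarrow>
    (\<Sum>k\<le>n. \<Sum>\<eta>\<in>T. pjumps j N k s \<xi> \<eta> * h \<eta>) \<le> exp (\<mu> * s) * h \<xi>"
proof (induction n arbitrary: s \<xi>)
  case 0
  have "(\<Sum>\<eta>\<in>T. pjumps j N 0 s \<xi> \<eta> * h \<eta>) = (if \<xi> \<in> T then exp (- exit_rate j N \<xi> * s) * h \<xi> else 0)"
    using T by (simp add: if_distrib[of "\<lambda>x. x * _"] cong: if_cong)
  moreover have "exit_rate j N \<xi> \<ge> 0" unfolding exit_rate_def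
    using transitions_rate_nonneg[OF j] by (intro sum_list_nonneg) auto
  hence "exp (- exit_rate j N \<xi> * s) \<le> exp (\<mu> * s)"
    using 0 mu by (simp only: exp_le_cancel_iff) (intro mult_right_mono, auto)
  ultimately show ?case using h 0 by (auto intro: mult_right_mono)
next
  case (Suc n)
  define q where "q = exit_rate j N \<xi>"
  have q: "q \<ge> 0" unfolding exit_rate_def q_def
    using transitions_rate_nonneg[OF j] by (intro sum_list_nonneg) auto
  define S where "S \<zeta> v = (\<Sum>k\<le>n. \<Sum>\<eta>\<in>T. pjumps j N k v \<zeta> \<eta> * h \<eta>)" for \<zeta> v
  have contp: "continuous_on {0..s} (\<lambda>u. pjumps j N k (s - u) \<zeta> \<eta>)" for k \<zeta> \<eta>
    by (intro continuous_on_compose2[OF continuous_on_pjumps]) (auto intro!: continuous_intros)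
  have conts: "continuous_on {0..s} (\<lambda>u. exp (- q * u) * sum_list (map (\<lambda>(r, \<zeta>). r * S \<zeta> (s - u)) (transitions j N \<xi>)))"
    unfolding S_def case_prod_unfold by (intro continuous_intros continuous_on_sum_list contp)
  have "(\<Sum>k\<le>n. \<Sum>\<eta>\<in>T. pjumps j N (Suc k) s \<xi> \<eta> * h \<eta>)
      = (\<Sum>k\<le>n. \<Sum>\<eta>\<in>T. integral {0..s} (\<lambda>u. exp (- q * u) *
          sum_list (map (\<lambda>(r, \<zeta>). r * pjumps j N k (s - u) \<zeta> \<eta>) (transitions j N \<xi>)) * h \<eta>))"
    unfolding pjumps.simps q_def by simp
  also have "\<dots> = integral {0..s} (\<lambda>u. \<Sum>k\<le>n. \<Sum>\<eta>\<in>T. exp (- q * u) *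
          sum_list (map (\<lambda>(r, \<zeta>). r * pjumps j N k (s - u) \<zeta> \<eta>) (transitions j N \<xi>)) * h \<eta>)"
    using T by (subst integral_sum, simp, force intro!: integrable_continuous_interval continuous_intros continuous_on_sum_list contp simp: case_prod_unfold)
      (subst integral_sum, simp, auto intro!: integrable_continuous_interval continuous_intros continuous_on_sum_list contp simp: case_prod_unfold)
  also have "(\<lambda>u. \<Sum>k\<le>n. \<Sum>\<eta>\<in>T. exp (- q * u) *
          sum_list (map (\<lambda>(r, \<zeta>). r * pjumps j N k (s - u) \<zeta> \<eta>) (transitions j N \<xi>)) * h \<eta>)
     = (\<lambda>u. exp (- q * u) * sum_list (map (\<lambda>(r, \<zeta>). r * S \<zeta> (s - u)) (transitions j N \<xi>)))"
    unfolding S_def case_prod_unfold sum_list_const_mult[symmetric] sum_list_mult_const[symmetric] sum_sum_list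
    by (intro ext arg_cong[where f = sum_list] map_cong refl) (simp add: sum_distrib_left sum_distrib_right mult_ac)
  also have "integral {0..s} \<dots> \<le> integral {0..s} (\<lambda>u. (\<mu> + q) * h \<xi> * exp (\<mu> * s) * exp (- (\<mu> + q) * u))"
  proof (intro integral_le integrable_continuous_interval conts)
    fix u assume u: "u \<in> {0..s}"
    have "sum_list (map (\<lambda>(r, \<zeta>). r * S \<zeta> (s - u)) (transitions j N \<xi>))
        \<le> sum_list (map (\<lambda>(r, \<zeta>). exp (\<mu> * (s - u)) * (r * h \<zeta>)) (transitions j N \<xi>))"
    proof (intro sum_list_mono, clarsimp)
      fix r \<zeta> assume *: "(r, \<zeta>) \<in> set (transitions j N \<xi>)"
      have "S \<zeta> (s - u) \<le> exp (\<mu> * (s - u)) * h \<zeta>"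
        unfolding S_def using u transitions_is_config[OF Suc.prems(2) *] by (intro Suc.IH) auto
      from mult_left_mono[OF this transitions_rate_nonneg[OF j *]]
      show "r * S \<zeta> (s - u) \<le> exp (\<mu> * (s - u)) * (r * h \<zeta>)" by (simp add: mult_ac)
    qed
    also have "\<dots> = exp (\<mu> * (s - u)) * sum_list (map (\<lambda>(r, \<zeta>). r * h \<zeta>) (transitions j N \<xi>))"
      by (simp add: sum_list_const_mult case_prod_unfold)
    also have "\<dots> \<le> exp (\<mu> * (s - u)) * ((\<mu> + q) * h \<xi>)"
      unfolding q_def by (intro mult_left_mono gen Suc.prems) auto
    finally have "exp (- q * u) * sum_list (map (\<lambda>(r, \<zeta>). r * S \<zeta> (s - u)) (transitions j N \<xi>))
       \<le> exp (- q * u) * (exp (\<mu> * (s - u)) * ((\<mu> + q) * h \<xi>))" by simp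
    also have "\<dots> = (\<mu> + q) * h \<xi> * (exp (\<mu> * s + - (\<mu> + q) * u))"
      by (simp add: algebra_simps flip: exp_add)
    also have "\<dots> = (\<mu> + q) * h \<xi> * exp (\<mu> * s) * exp (- (\<mu> + q) * u)"
      by (simp only: exp_add mult.assoc)
    finally show "exp (- q * u) * sum_list (map (\<lambda>(r, \<zeta>). r * S \<zeta> (s - u)) (transitions j N \<xi>))
       \<le> (\<mu> + q) * h \<xi> * exp (\<mu> * s) * exp (- (\<mu> + q) * u)" .
  qed (auto intro!: continuous_intros)
  also have "\<dots> = (- h \<xi> * exp (\<mu> * s) * exp (- (\<mu> + q) * s)) - (- h \<xi> * exp (\<mu> * s) * exp (- (\<mu> + q) * 0))"
    using mu q Suc.prems
    by (intro integral_unique fundamental_theorem_of_calculus)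
       (auto intro!: derivative_eq_intros simp: algebra_simps simp flip: has_real_derivative_iff_has_vector_derivative)
  also have "\<dots> = exp (\<mu> * s) * h \<xi> - exp (\<mu> * s + - (\<mu> + q) * s) * h \<xi>"
    by (simp only: exp_add) (simp add: algebra_simps)
  also have "\<mu> * s + - (\<mu> + q) * s = - q * s" by (simp add: algebra_simps)
  finally have A: "(\<Sum>k\<le>n. \<Sum>\<eta>\<in>T. pjumps j N (Suc k) s \<xi> \<eta> * h \<eta>)
      \<le> exp (\<mu> * s) * h \<xi> - exp (- q * s) * h \<xi>" .
  have "(\<Sum>\<eta>\<in>T. pjumps j N 0 s \<xi> \<eta> * h \<eta>) = (if \<xi> \<in> T then exp (- q * s) * h \<xi> else 0)"
    using T by (simp add: if_distrib[of "\<lambda>x. x * _"] q_def cong: if_cong)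
  also have "\<dots> \<le> exp (- q * s) * h \<xi>" using h Suc.prems by auto
  finally show ?case using A
    by (simp only: sum.atMost_Suc_shift)
qed

text \<open>The terms are nonnegative with partial sums at most \<open>exp s\<close>: this is the
  Lyapunov estimate for the constant function \<open>1\<close> with \<open>\<mu> = 1\<close> on the
  singleton \<open>{\<eta>}\<close>.\<close>

lemma ptrans_sums:
  assumes "0 \<le> j" "0 \<le> s" "is_config N \<xi>"
  shows "(\<lambda>n. pjumps j N n s \<xi> \<eta>) sums ptrans j N s \<xi> \<eta>"
proof -
  have "summable (\<lambda>n. pjumps j N n s \<xi> \<eta>)"
  proof (rule summableI_nonneg_bounded)
    show "0 \<le> pjumps j N n s \<xi> \<eta>" for n using assms by (intro pjumps_nonneg)
    fix n
    have "(\<Sum>k\<le>n. \<Sum>\<eta>\<in>{\<eta>}. pjumps j N k s \<xi> \<eta> * 1) \<le> exp (1 * s) * 1"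
      using assms
      by (intro pjumps_lyapunov) (auto simp: exit_rate_def case_prod_unfold)
    moreover have "(\<Sum>k<n. pjumps j N k s \<xi> \<eta>) \<le> (\<Sum>k\<le>n. pjumps j N k s \<xi> \<eta>)"
      using assms by (intro sum_mono2) (auto intro: pjumps_nonneg)
    ultimately show "(\<Sum>k<n. pjumps j N k s \<xi> \<eta>) \<le> exp s" by simp
  qed
  thus ?thesis unfolding ptrans_def by (rule summable_sums)
qed

text \<open>Markov's inequality for \<open>h\<close>, first on finite subsets of the event; the
  common bound passes to \<open>infsum\<close>.\<close>

lemma prob_at_markov:
  assumes j: "0 \<le> j" and mu: "0 < \<mu>"
    and h: "\<And>\<xi>. is_config N \<xi> \<Longrightarrow> 0 \<le> h \<xi>"
    and gen: "\<And>\<xi>. is_config N \<xi> \<Longrightarrow>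
      sum_list (map (\<lambda>(r, \<zeta>). r * h \<zeta>) (transitions j N \<xi>)) \<le> (\<mu> + exit_rate j N \<xi>) * h \<xi>"
    and s: "0 \<le> s" and \<xi>: "is_config N \<xi>"
    and B: "0 < B" "\<And>\<eta>. is_config N \<eta> \<Longrightarrow> E \<eta> \<Longrightarrow> B \<le> h \<eta>"
  shows "prob_at j N \<xi> s E \<le> exp (\<mu> * s) * h \<xi> / B"
proof -
  define U where "U = {\<eta>. is_config N \<eta> \<and> E \<eta>}"
  have nonneg: "0 \<le> ptrans j N s \<xi> \<eta>" for \<eta>
    using sums_le[OF _ sums_zero ptrans_sums[OF j s \<xi>]] pjumps_nonneg[OF j s] by simp
  have bound: "(\<Sum>\<eta>\<in>T. ptrans j N s \<xi> \<eta>) \<le> exp (\<mu> * s) * h \<xi> / B"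
    if T: "finite T" "T \<subseteq> U" for T
  proof -
    have "(\<lambda>n. \<Sum>\<eta>\<in>T. pjumps j N n s \<xi> \<eta> * h \<eta>) sums (\<Sum>\<eta>\<in>T. ptrans j N s \<xi> \<eta> * h \<eta>)"
      by (intro sums_sum sums_mult2 ptrans_sums j s \<xi>)
    hence "(\<lambda>n. \<Sum>k\<le>n. \<Sum>\<eta>\<in>T. pjumps j N k s \<xi> \<eta> * h \<eta>) \<longlonglongrightarrow> (\<Sum>\<eta>\<in>T. ptrans j N s \<xi> \<eta> * h \<eta>)"
      by (simp add: sums_def_le)
    hence "(\<Sum>\<eta>\<in>T. ptrans j N s \<xi> \<eta> * h \<eta>) \<le> exp (\<mu> * s) * h \<xi>"
      by (rule tendsto_upperbound)
         (auto intro!: always_eventually pjumps_lyapunov[OF j mu T(1) h gen s \<xi>])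
    moreover have "(\<Sum>\<eta>\<in>T. ptrans j N s \<xi> \<eta> * B) \<le> (\<Sum>\<eta>\<in>T. ptrans j N s \<xi> \<eta> * h \<eta>)"
      using T B nonneg by (intro sum_mono mult_left_mono) (auto simp: U_def)
    ultimately show ?thesis using B(1) by (simp add: sum_distrib_right[symmetric] pos_le_divide_eq)
  qed
  have "ptrans j N s \<xi> summable_on U"
    using bound nonneg by (intro nonneg_bdd_above_summable_on) (auto intro!: bdd_aboveI)
  thus ?thesis unfolding prob_at_def U_def[symmetric]
    by (intro infsum_le_finite_sums bound)
qed

subsection \<open>The killed simple random walk\<close>

text \<open>Transition operator of the walk on \<open>{1..N}\<close>. It reads \<open>f\<close> at
  \<open>0\<close> and \<open>N + 1\<close> too, so it describes killing there only for arguments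
  satisfying \<open>dirichlet\<close>; its values always satisfy it.\<close>

definition dwalk :: "nat \<Rightarrow> (nat \<Rightarrow> real) \<Rightarrow> nat \<Rightarrow> real" where
  "dwalk N f x = (if x \<in> {1..N} then (f (x - 1) + f (x + 1)) / 2 else 0)"

definition dirichlet :: "nat \<Rightarrow> (nat \<Rightarrow> real) \<Rightarrow> bool" where
  "dirichlet N f \<longleftrightarrow> (\<forall>x. x \<notin> {1..N} \<longrightarrow> f x = 0)"

definition inprod :: "nat \<Rightarrow> (nat \<Rightarrow> real) \<Rightarrow> (nat \<Rightarrow> real) \<Rightarrow> real" where
  "inprod N f g = (\<Sum>x=1..N. f x * g x)"

abbreviation dwalks :: "nat \<Rightarrow> nat \<Rightarrow> (nat \<Rightarrow> real) \<Rightarrow> nat \<Rightarrow> real" where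
  "dwalks N n \<equiv> (dwalk N ^^ n)"

lemma dirichlet_dwalk [simp]: "dirichlet N (dwalk N f)"
  by (auto simp: dirichlet_def dwalk_def)

lemma dwalks_Suc:
  "dwalks N (Suc n) f x = (if x \<in> {1..N} then (dwalks N n f (x - 1) + dwalks N n f (x + 1)) / 2 else 0)"
  using dwalk_def[of N "dwalks N n f" x] by simp

lemma dirichlet_dwalks: "dirichlet N f \<Longrightarrow> dirichlet N (dwalks N n f)"
  by (cases n) auto

lemma dwalks_add: "dwalks N n (\<lambda>x. f x + g x) x = dwalks N n f x + dwalks N n g x"
  by (induction n arbitrary: x) (auto simp: dwalks_Suc algebra_simps add_divide_distrib diff_divide_distrib simp del: funpow.simps(2))

lemma dwalks_cmult: "dwalks N n (\<lambda>x. c * f x) x = c * dwalks N n f x"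
  by (induction n arbitrary: x) (auto simp: dwalks_Suc algebra_simps add_divide_distrib diff_divide_distrib simp del: funpow.simps(2))

lemma dwalks_diff: "dwalks N n (\<lambda>x. f x - g x) x = dwalks N n f x - dwalks N n g x"
  using dwalks_add[of n N "\<lambda>x. f x - g x" g x] by simp

lemma inprod_commute: "inprod N f g = inprod N g f"
  by (simp add: inprod_def mult.commute)

lemma sum_shift_nat: "(\<Sum>x=1..N. f (x - 1)) = (\<Sum>x<N. f x)" for f :: "nat \<Rightarrow> real"
  by (rule sum.reindex_bij_witness[of _ Suc "\<lambda>x. x - 1"]) auto

text \<open>Index shift; the boundary terms \<open>f (N + 1) * g N\<close> and
  \<open>f 1 * g 0\<close> vanish. This is the summation by parts behind the symmetry of the
  walk.\<close>

lemma sum_neighbour_products: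
  assumes "dirichlet N f" "dirichlet N g"
  shows "(\<Sum>x=1..N. f (x + 1) * g x) = (\<Sum>x=1..N. f x * g (x - 1))"
proof -
  have "(\<Sum>x=1..N. f x * g (x - 1)) = (\<Sum>x<N. f (Suc x) * g x)"
    unfolding sum_shift_nat[symmetric] by (intro sum.cong) auto
  also have "\<dots> = (\<Sum>x\<le>N. f (Suc x) * g x)"
    using assms by (simp add: lessThan_Suc_atMost[symmetric] dirichlet_def)
  also have "\<dots> = (\<Sum>x=1..N. f (Suc x) * g x)"
    using assms by (intro sum.mono_neutral_right) (auto simp: dirichlet_def not_less_eq_eq)
  finally show ?thesis by simp
qed

lemma inprod_dwalk:
  assumes "dirichlet N f" "dirichlet N g"
  shows "inprod N (dwalk N f) g = inprod N f (dwalk N g)"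
proof -
  have "2 * inprod N (dwalk N f) g = (\<Sum>x=1..N. f (x - 1) * g x) + (\<Sum>x=1..N. f (x + 1) * g x)"
    by (auto simp: inprod_def dwalk_def sum_distrib_left sum.distrib[symmetric] algebra_simps add_divide_distrib intro!: sum.cong)
  also have "\<dots> = (\<Sum>x=1..N. g (x + 1) * f x) + (\<Sum>x=1..N. g (x - 1) * f x)"
    using sum_neighbour_products[OF assms] sum_neighbour_products[OF assms(2,1)]
    by (simp add: mult.commute)
  also have "\<dots> = 2 * inprod N f (dwalk N g)"
    by (auto simp: inprod_def dwalk_def sum_distrib_left sum.distrib[symmetric] algebra_simps add_divide_distrib intro!: sum.cong)
  finally show ?thesis by simp
qed

lemma inprod_dwalks:
  assumes "dirichlet N f" "dirichlet N g"
  shows "inprod N (dwalks N n f) g = inprod N f (dwalks N n g)"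
  using assms(1)
proof (induction n arbitrary: f)
  case (Suc n)
  have "inprod N (dwalks N (Suc n) f) g = inprod N (dwalks N n (dwalk N f)) g"
    by (simp only: funpow_Suc_right o_def)
  also have "\<dots> = inprod N f (dwalks N (Suc n) g)"
    using Suc.prems assms(2) by (subst Suc.IH) (simp_all add: inprod_dwalk dirichlet_dwalks)
  finally show ?case .
qed simp

text \<open>By \<open>2ab \<le> a^2 + b^2\<close>. The walk minus the identity is thus negative
  semidefinite, which is the dissipation by the diffusion.\<close>

lemma inprod_dwalk_le:
  assumes "dirichlet N f"
  shows "inprod N (dwalk N f) f \<le> inprod N f f"
proof -
  have A: "(\<Sum>x=1..N. f (x - 1) * f (x - 1)) \<le> inprod N f f"
    "(\<Sum>x=1..N. f (x + 1) * f (x + 1)) \<le> inprod N f f"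
  proof -
    have "(\<Sum>x=1..N. f (x - 1) * f (x - 1)) = (\<Sum>x<N. f x * f x)"
      by (rule sum_shift_nat)
    also have "\<dots> \<le> (\<Sum>x\<le>N. f x * f x)" by (intro sum_mono2) auto
    also have "\<dots> = inprod N f f" unfolding inprod_def
      using assms by (intro sum.mono_neutral_right) (auto simp: dirichlet_def not_less_eq_eq)
    finally show "(\<Sum>x=1..N. f (x - 1) * f (x - 1)) \<le> inprod N f f" .
    have "(\<Sum>x=1..N. f (x + 1) * f (x + 1)) = (\<Sum>x=2..Suc N. f x * f x)"
      by (rule sum.reindex_bij_witness[of _ "\<lambda>x. x - 1" Suc]) auto
    also have "\<dots> = (\<Sum>x=2..N. f x * f x)"
      using assms by (intro sum.mono_neutral_right) (auto simp: dirichlet_def)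
    also have "\<dots> \<le> (\<Sum>x=1..N. f x * f x)" by (intro sum_mono2) auto
    finally show "(\<Sum>x=1..N. f (x + 1) * f (x + 1)) \<le> inprod N f f" by (simp add: inprod_def)
  qed
  have "4 * inprod N (dwalk N f) f = (\<Sum>x=1..N. 2 * (f (x - 1) * f x) + 2 * (f (x + 1) * f x))"
    by (auto simp: inprod_def dwalk_def sum_distrib_left algebra_simps add_divide_distrib intro!: sum.cong)
  also have "\<dots> \<le> (\<Sum>x=1..N. (f (x - 1) * f (x - 1) + f x * f x) + (f (x + 1) * f (x + 1) + f x * f x))"
    using sum_squares_bound by (intro sum_mono add_mono) (auto simp: power2_eq_square mult.assoc[symmetric])
  also have "\<dots> \<le> 4 * inprod N f f" using A by (simp add: sum.distrib inprod_def sum_distrib_left[symmetric])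
  finally show ?thesis by simp
qed

lemma dwalk_l1:
  assumes "dirichlet N f"
  shows "(\<Sum>x=1..N. \<bar>dwalk N f x\<bar>) \<le> (\<Sum>x=1..N. \<bar>f x\<bar>)"
proof -
  have "(\<Sum>x=1..N. \<bar>f (x - 1)\<bar>) = (\<Sum>x<N. \<bar>f x\<bar>)" by (rule sum_shift_nat)
  also have "\<dots> \<le> (\<Sum>x\<le>N. \<bar>f x\<bar>)" by (intro sum_mono2) auto
  also have "\<dots> = (\<Sum>x=1..N. \<bar>f x\<bar>)"
    using assms by (intro sum.mono_neutral_right) (auto simp: dirichlet_def not_less_eq_eq)
  finally have A: "(\<Sum>x=1..N. \<bar>f (x - 1)\<bar>) \<le> (\<Sum>x=1..N. \<bar>f x\<bar>)" .
  have "(\<Sum>x=1..N. \<bar>f (x + 1)\<bar>) = (\<Sum>x=2..Suc N. \<bar>f x\<bar>)"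
    by (rule sum.reindex_bij_witness[of _ "\<lambda>x. x - 1" Suc]) auto
  also have "\<dots> = (\<Sum>x=2..N. \<bar>f x\<bar>)"
    using assms by (intro sum.mono_neutral_right) (auto simp: dirichlet_def)
  also have "\<dots> \<le> (\<Sum>x=1..N. \<bar>f x\<bar>)" by (intro sum_mono2) auto
  finally have B: "(\<Sum>x=1..N. \<bar>f (x + 1)\<bar>) \<le> (\<Sum>x=1..N. \<bar>f x\<bar>)" .
  have "2 * (\<Sum>x=1..N. \<bar>dwalk N f x\<bar>) \<le> (\<Sum>x=1..N. \<bar>f (x - 1)\<bar> + \<bar>f (x + 1)\<bar>)"
    unfolding sum_distrib_left by (intro sum_mono) (auto simp: dwalk_def)
  with A B show ?thesis by (simp add: sum.distrib)
qed

lemma dwalks_l1: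
  assumes "dirichlet N f"
  shows "(\<Sum>x=1..N. \<bar>dwalks N n f x\<bar>) \<le> (\<Sum>x=1..N. \<bar>f x\<bar>)"
proof (induction n)
  case (Suc n)
  thus ?case using dwalk_l1[OF dirichlet_dwalks[OF assms, of n]] by simp
qed simp

lemma dwalks_sup:
  assumes "\<And>x. \<bar>f x\<bar> \<le> B"
  shows "\<bar>dwalks N n f x\<bar> \<le> B"
proof (induction n arbitrary: x)
  case (Suc n)
  have "0 \<le> B" using assms[of 0] by linarith
  thus ?case using Suc[of "x - 1"] Suc[of "x + 1"] by (auto simp: dwalk_def)
qed (use assms in auto)

text \<open>With \<open>P = dwalk N\<close>, the difference \<open>P^n f - f\<close> telescopes into
  \<open>n\<close> terms \<open>P^k (P f - f)\<close>, and \<open>P\<close> contracts the l1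
  norm.\<close>

lemma dwalks_diff_l1:
  assumes "dirichlet N f"
  shows "(\<Sum>x=1..N. \<bar>dwalks N n f x - f x\<bar>) \<le> n * (\<Sum>x=1..N. \<bar>dwalk N f x - f x\<bar>)"
proof (induction n)
  case (Suc n)
  define g where "g x = dwalk N f x - f x" for x
  have g: "dirichlet N g" using assms by (auto simp: dirichlet_def g_def dwalk_def)
  have eq: "dwalks N (Suc n) f x - f x = dwalks N n g x + (dwalks N n f x - f x)" for x
    unfolding g_def dwalks_diff by (simp add: funpow_swap1)
  have "(\<Sum>x=1..N. \<bar>dwalks N (Suc n) f x - f x\<bar>)
      \<le> (\<Sum>x=1..N. \<bar>dwalks N n g x\<bar>) + (\<Sum>x=1..N. \<bar>dwalks N n f x - f x\<bar>)"
    unfolding eq sum.distrib[symmetric] by (intro sum_mono abs_triangle_ineq)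
  also have "\<dots> \<le> (\<Sum>x=1..N. \<bar>g x\<bar>) + n * (\<Sum>x=1..N. \<bar>dwalk N f x - f x\<bar>)"
    by (intro add_mono dwalks_l1 g Suc)
  finally show ?case by (simp add: g_def algebra_simps)
qed simp

text \<open>In \<open>n\<close> steps the walk from \<open>x\<close> stays within distance
  \<open>n\<close>, hence inside \<open>{1..N}\<close>: nothing is killed and only values of
  \<open>f\<close> near \<open>x\<close> are averaged.\<close>

lemma dwalks_ge:
  assumes "\<And>y. x \<le> y + n \<Longrightarrow> y \<le> x + n \<Longrightarrow> w \<le> f y" "n < x" "x + n \<le> N"
  shows "w \<le> dwalks N n f x"
  using assms
proof (induction n arbitrary: x)
  case (Suc n)
  have "w \<le> dwalks N n f (x - 1)" "w \<le> dwalks N n f (x + 1)"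
    using Suc.prems by (auto intro!: Suc.IH)
  thus ?case using Suc.prems by (auto simp: dwalks_Suc simp del: funpow.simps(2))
qed auto

section \<open>Decay of the return probability\<close>

text \<open>An integer lower index, with value 0 below 0, frees Pascal's rule from side
  conditions.\<close>

definition ibinom :: "nat \<Rightarrow> int \<Rightarrow> real" where
  "ibinom n k = (if k < 0 then 0 else real (n choose nat k))"

lemma ibinom_Suc: "ibinom (Suc n) k = ibinom n k + ibinom n (k - 1)"
proof (cases "k > 0")
  case True
  hence "nat k = Suc (nat (k - 1))" by simp
  thus ?thesis using True by (simp add: ibinom_def)
qed (auto simp: ibinom_def)

text \<open>Killing only loses paths, so the number of free paths is an upper bound; the lower index
  counts the steps in one direction. For odd \<open>n + y - x\<close> the left side is 0 and the
  rounding by \<open>div\<close> does no harm.\<close>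

lemma dwalks_delta_le:
  "2 ^ n * dwalks N n (\<lambda>y. of_bool (y = x)) y \<le> ibinom n ((int n + int y - int x) div 2)"
proof (induction n arbitrary: y)
  case (Suc n)
  define k where "k = (int (Suc n) + int y - int x) div 2"
  show ?case
  proof (cases "y \<in> {1..N}")
    case True
    have "2 ^ Suc n * dwalks N (Suc n) (\<lambda>y. of_bool (y = x)) y =
       2 ^ n * dwalks N n (\<lambda>y. of_bool (y = x)) (y - 1) + 2 ^ n * dwalks N n (\<lambda>y. of_bool (y = x)) (y + 1)"
      using True by (simp add: dwalk_def field_simps)
    also have "\<dots> \<le> ibinom n ((int n + int (y - 1) - int x) div 2) + ibinom n ((int n + int (y + 1) - int x) div 2)"
      by (intro add_mono Suc)
    also have "(int n + int (y + 1) - int x) div 2 = k" by (simp add: k_def algebra_simps)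
    also have "(int n + int (y - 1) - int x) div 2 = k - 1" using True by (simp add: k_def of_nat_diff)
    finally show ?thesis by (simp add: ibinom_Suc k_def)
  qed (auto simp: dwalk_def ibinom_def)
qed (auto simp: ibinom_def)

text \<open>The largest probability that the free walk gives to a point after \<open>n\<close>
  steps.\<close>

definition delta_bound :: "nat \<Rightarrow> real" where
  "delta_bound n = real (n choose (n div 2)) / 2 ^ n"

lemma dwalks_nonneg: "(\<And>x. 0 \<le> f x) \<Longrightarrow> 0 \<le> dwalks N n f x"
  by (induction n arbitrary: x) (auto simp: dwalk_def)

text \<open>A sum of squares is at most the supremum times the l1 norm, and the walk does not
  increase the l1 norm, which starts at 1. By symmetry the left side is the return probability after
  \<open>2 * n\<close> steps.\<close>

lemma dwalks_delta_energy:
  assumes "x \<in> {1..N}"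
  defines "\<delta> \<equiv> \<lambda>y. of_bool (y = x)"
  shows "inprod N (dwalks N n \<delta>) (dwalks N n \<delta>) \<le> delta_bound n"
proof -
  have nonneg: "0 \<le> dwalks N n \<delta> y" for y by (rule dwalks_nonneg) (simp add: \<delta>_def)
  have le: "dwalks N n \<delta> y \<le> delta_bound n" for y
  proof -
    have "2 ^ n * dwalks N n \<delta> y \<le> real (n choose (n div 2))"
      using dwalks_delta_le[of n N x y] binomial_maximum[of n]
      unfolding ibinom_def \<delta>_def
      by (smt (verit) of_nat_0_le_iff of_nat_mono)
    thus ?thesis by (simp add: delta_bound_def field_simps)
  qed
  have "inprod N (dwalks N n \<delta>) (dwalks N n \<delta>) \<le> (\<Sum>y=1..N. delta_bound n * \<bar>dwalks N n \<delta> y\<bar>)"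
    unfolding inprod_def using nonneg le by (intro sum_mono) (auto intro: mult_right_mono)
  also have "\<dots> \<le> delta_bound n * (\<Sum>y=1..N. \<bar>\<delta> y\<bar>)"
    unfolding sum_distrib_left[symmetric]
    using assms(1) by (intro mult_left_mono dwalks_l1) (auto simp: dirichlet_def \<delta>_def delta_bound_def)
  also have "(\<Sum>y=1..N. \<bar>\<delta> y\<bar>) = 1" using assms(1) by (simp add: \<delta>_def of_bool_def)
  finally show ?thesis by simp
qed

text \<open>Consecutive even terms have the ratio \<open>(2 * m + 1) / (2 * m + 2)\<close>, and the
  induction closes by \<open>(2 * m + 1) * (2 * m + 3) \<le> (2 * m + 2)^2\<close>.\<close>

lemma delta_bound_even: "delta_bound (2 * m) ^ 2 \<le> 1 / real (2 * m + 1)"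
proof (induction m)
  case (Suc m)
  have "Suc m * (Suc m * (Suc (Suc (2 * m)) choose Suc m)) = Suc (Suc (2 * m)) * (Suc m * (Suc (2 * m) choose m))"
    by (simp only: Suc_times_binomial_eq mult_ac)
  also have "Suc (2 * m) choose m = Suc (2 * m) choose Suc m"
    by (subst binomial_symmetric) auto
  also have "Suc m * \<dots> = Suc (2 * m) * (2 * m choose m)"
    by (simp only: Suc_times_binomial_eq mult_ac)
  also have "Suc (Suc (2 * m)) * \<dots> = Suc m * (2 * Suc (2 * m) * (2 * m choose m))"
    by (simp add: algebra_simps)
  finally have "Suc m * (Suc (Suc (2 * m)) choose Suc m) = 2 * Suc (2 * m) * (2 * m choose m)"
    by (simp only: mult_cancel1) simp
  hence "real (Suc m) * real (2 * Suc m choose Suc m) = 2 * real (2 * m + 1) * real (2 * m choose m)"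
    by (metis Suc_eq_plus1 add_2_eq_Suc mult_Suc_right of_nat_mult of_nat_numeral)
  hence *: "real (2 * Suc m choose Suc m) = 2 * real (2 * m + 1) * real (2 * m choose m) / real (Suc m)"
    by (metis nonzero_mult_div_cancel_left of_nat_eq_0_iff nat.distinct(2))
  have "delta_bound (2 * Suc m) = real (2 * Suc m choose Suc m) / (4 * 2 ^ (2 * m))"
    by (simp add: delta_bound_def)
  also have "\<dots> = real (2 * m choose m) / 2 ^ (2 * m) * (real (2 * m + 1) / (2 * real (Suc m)))"
  proof -
    have "2 * (2 * q + 1) * Y / (q + 1) / (4 * P) = Y / P * ((2 * q + 1) / (2 * (q + 1)))"
      if "P > 0" "q \<ge> 0" for Y P q :: real
      using that by (simp add: divide_simps) (simp add: algebra_simps)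
    from this[of "2 ^ (2 * m)" "real m" "real (2 * m choose m)"] show ?thesis unfolding * by (simp add: add.commute)
  qed
  also have "\<dots> = delta_bound (2 * m) * ((2 * m + 1) / (2 * m + 2))"
    by (simp add: delta_bound_def)
  finally have "delta_bound (2 * Suc m) = delta_bound (2 * m) * ((2 * m + 1) / (2 * m + 2))" .
  hence "delta_bound (2 * Suc m) ^ 2 = delta_bound (2 * m) ^ 2 * ((2 * m + 1) / (2 * m + 2)) ^ 2"
    by (simp only: power_mult_distrib)
  also have "\<dots> \<le> 1 / (2 * m + 1) * ((2 * m + 1) / (2 * m + 2)) ^ 2"
    by (intro mult_right_mono Suc) auto
  also have "\<dots> \<le> 1 / (2 * Suc m + 1)"
  proof -
    have "1 / a * (a / b)\<^sup>2 \<le> 1 / c" if "0 < a" "0 < b" "0 < c" "a * c \<le> b\<^sup>2" for a b c :: real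
      using that by (simp add: power2_eq_square divide_simps)
    from this[of "real (2 * m + 1)" "real (2 * m + 2)" "real (2 * Suc m + 1)"] show ?thesis
      by (simp add: power2_eq_square algebra_simps)
  qed
  finally show ?case .
qed (simp add: delta_bound_def)

lemma delta_bound_tendsto: "(\<lambda>m. delta_bound (2 * m)) \<longlonglongrightarrow> 0"
proof (rule tendsto_sandwich[of "\<lambda>_. 0"])
  show "\<forall>\<^sub>F m in sequentially. delta_bound (2 * m) \<le> sqrt (1 / real (2 * m + 1))"
    by (intro always_eventually allI real_le_rsqrt delta_bound_even)
  show "(\<lambda>m. sqrt (1 / real (2 * m + 1))) \<longlonglongrightarrow> 0"
    by real_asymp
qed (auto simp: delta_bound_def)

subsection \<open>Generator bounds\<close>

definition tailsum :: "nat \<Rightarrow> (nat \<Rightarrow> nat) \<Rightarrow> nat \<Rightarrow> real" where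
  "tailsum N \<xi> x = (\<Sum>y=x..N. real (\<xi> y))"

definition hat :: "nat \<Rightarrow> nat \<Rightarrow> real" where
  "hat N x = 1 - real x / real (N + 1)"

definition deviation :: "nat \<Rightarrow> (nat \<Rightarrow> real) \<Rightarrow> (nat \<Rightarrow> nat) \<Rightarrow> nat \<Rightarrow> real" where
  "deviation N G \<xi> x = tailsum N \<xi> x - G x"

text \<open>\<open>hat\<close> is harmonic with boundary values 1 and 0. Subtracting its multiple
  gives zero boundary values, as the symmetry of \<open>dwalk\<close> requires, without changing
  second differences inside.\<close>

definition bridge :: "nat \<Rightarrow> (nat \<Rightarrow> real) \<Rightarrow> (nat \<Rightarrow> nat) \<Rightarrow> nat \<Rightarrow> real" where
  "bridge N G \<xi> x =
     (if x \<in> {1..N} then deviation N G \<xi> x - deviation N G \<xi> 0 * hat N x else 0)"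

definition energy :: "nat \<Rightarrow> nat \<Rightarrow> (nat \<Rightarrow> real) \<Rightarrow> real" where
  "energy N n f = inprod N (dwalks N n f) (dwalks N n f)"

definition gen :: "real \<Rightarrow> nat \<Rightarrow> ((nat \<Rightarrow> nat) \<Rightarrow> real) \<Rightarrow> (nat \<Rightarrow> nat) \<Rightarrow> real" where
  "gen j N \<phi> \<xi> = sum_list (map (\<lambda>(r, \<zeta>). r * (\<phi> \<zeta> - \<phi> \<xi>)) (transitions j N \<xi>))"

lemma hat_bounds: "x \<le> N + 1 \<Longrightarrow> 0 \<le> hat N x" "x \<le> N + 1 \<Longrightarrow> hat N x \<le> 1"
  by (auto simp: hat_def divide_simps)

lemma dirichlet_bridge [simp]: "dirichlet N (bridge N G \<xi>)"
  by (auto simp: dirichlet_def bridge_def)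

section \<open>Effect of the jumps on the tail sums\<close>

lemma tailsum_nonneg: "0 \<le> tailsum N \<xi> x"
  by (simp add: tailsum_def sum_nonneg)

lemma tailsum_rec: "x \<le> N \<Longrightarrow> tailsum N \<xi> x = real (\<xi> x) + tailsum N \<xi> (Suc x)"
  by (simp add: tailsum_def sum.atLeast_Suc_atMost)

lemma tailsum_outside: "N < x \<Longrightarrow> tailsum N \<xi> x = 0"
  by (simp add: tailsum_def)

lemma tailsum_update:
  "tailsum N (\<xi>(y := v)) x = tailsum N \<xi> x + of_bool (x \<le> y \<and> y \<le> N) * (real v - real (\<xi> y))"
proof (cases "x \<le> y \<and> y \<le> N")
  case True
  hence "tailsum N (\<xi>(y := v)) x = real v + (\<Sum>z\<in>{x..N}-{y}. real (\<xi> z))"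
    "tailsum N \<xi> x = real (\<xi> y) + (\<Sum>z\<in>{x..N}-{y}. real (\<xi> z))"
    unfolding tailsum_def by (auto simp: sum.remove[of _ y])
  thus ?thesis using True by simp
next
  case False
  thus ?thesis by (auto simp: tailsum_def intro!: sum.cong)
qed

text \<open>Only the tail from \<open>Suc x\<close> contains one of the two sites and not the other,
  so a bulk jump is a unit change at a single point.\<close>

lemma tailsum_move_right:
  assumes "x < N" "0 < \<xi> x"
  shows "tailsum N (move \<xi> x (Suc x)) z = tailsum N \<xi> z + of_bool (z = Suc x)"
  using assms by (auto simp: move_def tailsum_update of_nat_diff)

lemma tailsum_move_left:
  assumes "x < N" "0 < \<xi> (Suc x)"
  shows "tailsum N (move \<xi> (Suc x) x) z = tailsum N \<xi> z - of_bool (z = Suc x)"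
  using assms by (auto simp: move_def tailsum_update of_nat_diff)

lemma tailsum_birth: "tailsum N (\<xi>(0 := Suc (\<xi> 0))) z = tailsum N \<xi> z + of_bool (z = 0)"
  by (auto simp: tailsum_update)

lemma rightmost_props:
  assumes "\<exists>y\<le>N. 0 < \<xi> y"
  shows "rightmost N \<xi> \<le> N" "0 < \<xi> (rightmost N \<xi>)"
    "\<And>y. y \<le> N \<Longrightarrow> 0 < \<xi> y \<Longrightarrow> y \<le> rightmost N \<xi>"
proof -
  let ?S = "{y. y \<le> N \<and> 0 < \<xi> y}"
  have S: "finite ?S" "?S \<noteq> {}" using assms by auto
  have eq: "rightmost N \<xi> = Max ?S" using assms by (simp add: rightmost_def)
  show "rightmost N \<xi> \<le> N" "0 < \<xi> (rightmost N \<xi>)" using Max_in[OF S] eq by auto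
  show "y \<le> rightmost N \<xi>" if "y \<le> N" "0 < \<xi> y" for y
    unfolding eq using S that by (intro Max_ge) auto
qed

lemma tailsum_pos_iff:
  assumes "\<exists>y\<le>N. 0 < \<xi> y"
  shows "0 < tailsum N \<xi> z \<longleftrightarrow> z \<le> rightmost N \<xi>"
proof
  assume "0 < tailsum N \<xi> z"
  then obtain y where "y \<in> {z..N}" "\<xi> y > 0"
    unfolding tailsum_def by (metis (no_types, lifting) gr0I of_nat_0 order_less_irrefl sum.neutral)
  thus "z \<le> rightmost N \<xi>" using rightmost_props(3)[OF assms, of y] by auto
next
  assume "z \<le> rightmost N \<xi>"
  thus "0 < tailsum N \<xi> z" unfolding tailsum_def using rightmost_props(1,2)[OF assms]
    by (intro sum_pos2[of _ "rightmost N \<xi>"]) auto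
qed

text \<open>Tail sums are positive exactly up to the rightmost particle, so its removal acts as the
  term \<open>1(F > 0)\<close> of the limit equation.\<close>

lemma tailsum_death:
  assumes "\<exists>y\<le>N. 0 < \<xi> y"
  shows "tailsum N (\<xi>(rightmost N \<xi> := \<xi> (rightmost N \<xi>) - Suc 0)) z = tailsum N \<xi> z - of_bool (0 < tailsum N \<xi> z)"
  unfolding tailsum_pos_iff[OF assms] tailsum_update
  using rightmost_props(1,2)[OF assms] by (auto simp: of_nat_diff Suc_leI)

section \<open>The generator and the smoothed energy\<close>

lemma gen_eq:
  "gen j N \<phi> \<xi> = (\<Sum>x<N. real (\<xi> x) / 2 * (\<phi> (move \<xi> x (Suc x)) - \<phi> \<xi>)
       + real (\<xi> (Suc x)) / 2 * (\<phi> (move \<xi> (Suc x) x) - \<phi> \<xi>))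
     + j / N * (\<phi> (\<xi>(0 := Suc (\<xi> 0))) - \<phi> \<xi>)
     + (if \<exists>y\<le>N. 0 < \<xi> y
        then j / N * (\<phi> (\<xi>(rightmost N \<xi> := \<xi> (rightmost N \<xi>) - Suc 0)) - \<phi> \<xi>) else 0)"
proof (cases "\<exists>y\<le>N. 0 < \<xi> y")
  case True
  hence "(\<forall>y\<le>N. \<xi> y = 0) = False" by auto
  show ?thesis unfolding if_P[OF True] gen_def transitions_def \<open>(\<forall>y\<le>N. \<xi> y = 0) = False\<close> if_False
    by (simp add: o_def interv_sum_list_conv_sum_set_nat sum.distrib atLeast0LessThan)
next
  case False
  hence "\<forall>y\<le>N. \<xi> y = 0" by auto
  thus ?thesis unfolding if_not_P[OF False] gen_def transitions_def
    by (simp add: o_def interv_sum_list_conv_sum_set_nat sum.distrib atLeast0LessThan)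
qed

lemma gen_add: "gen j N (\<lambda>\<xi>. \<phi> \<xi> + \<psi> \<xi>) \<xi> = gen j N \<phi> \<xi> + gen j N \<psi> \<xi>"
  by (simp add: gen_def sum_list_addf[symmetric] case_prod_unfold algebra_simps)

lemma gen_cmult: "gen j N (\<lambda>\<xi>. c * \<phi> \<xi>) \<xi> = c * gen j N \<phi> \<xi>"
  by (simp add: gen_def sum_list_const_mult[symmetric] case_prod_unfold algebra_simps)

lemma gen_const: "gen j N (\<lambda>\<xi>. c) \<xi> = 0"
  by (simp add: gen_def case_prod_unfold)

lemma gen_le_iff:
  "sum_list (map (\<lambda>(r, \<zeta>). r * h \<zeta>) (transitions j N \<xi>)) \<le> (\<mu> + exit_rate j N \<xi>) * h \<xi>
   \<longleftrightarrow> gen j N h \<xi> \<le> \<mu> * h \<xi>"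
proof -
  have "gen j N h \<xi> = sum_list (map (\<lambda>(r, \<zeta>). r * h \<zeta>) (transitions j N \<xi>)) - exit_rate j N \<xi> * h \<xi>"
    by (simp add: gen_def exit_rate_def case_prod_unfold right_diff_distrib sum_list_subtractf sum_list_mult_const)
  thus ?thesis by (auto simp: distrib_right)
qed

lemma inprod_add_right: "inprod N f (\<lambda>x. g x + h x) = inprod N f g + inprod N f h"
  by (simp add: inprod_def sum.distrib algebra_simps)

lemma inprod_diff_right: "inprod N f (\<lambda>x. g x - h x) = inprod N f g - inprod N f h"
  by (simp add: inprod_def sum_subtractf algebra_simps)

lemma inprod_cmult_right: "inprod N f (\<lambda>x. c * g x) = c * inprod N f g"
  by (simp add: inprod_def sum_distrib_left algebra_simps)

lemma inprod_delta: "y \<in> {1..N} \<Longrightarrow> inprod N f (\<lambda>x. of_bool (x = y)) = f y"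
  by (simp add: inprod_def)

lemma inprod_cong: "(\<And>x. x \<in> {1..N} \<Longrightarrow> g x = h x) \<Longrightarrow> inprod N f g = inprod N f h"
  by (auto simp: inprod_def intro!: sum.cong)

lemma inprod_le_l1:
  assumes "\<And>x. x \<in> {1..N} \<Longrightarrow> \<bar>g x\<bar> \<le> 1"
  shows "\<bar>inprod N f g\<bar> \<le> (\<Sum>x=1..N. \<bar>f x\<bar>)"
proof -
  have "\<bar>inprod N f g\<bar> \<le> (\<Sum>x=1..N. \<bar>f x * g x\<bar>)" unfolding inprod_def by (rule sum_abs)
  also have "\<dots> \<le> (\<Sum>x=1..N. \<bar>f x\<bar>)"
    using assms by (intro sum_mono) (auto simp: abs_mult intro!: mult_left_le)
  finally show ?thesis .
qed

lemma energy_nonneg: "0 \<le> energy N n f"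
  by (simp add: energy_def inprod_def sum_nonneg)

text \<open>Expand the square and use the symmetry of the walk to collect all \<open>2 * n\<close>
  steps of the cross term on \<open>f\<close>.\<close>

lemma energy_add:
  assumes "dirichlet N f" "dirichlet N v"
  shows "energy N n (\<lambda>x. f x + v x) = energy N n f + 2 * inprod N (dwalks N (2 * n) f) v + energy N n v"
proof -
  have "inprod N (dwalks N (2 * n) f) v = inprod N (dwalks N n (dwalks N n f)) v"
    by (simp add: mult_2 funpow_add)
  also have "\<dots> = inprod N (dwalks N n f) (dwalks N n v)"
    using assms by (intro inprod_dwalks dirichlet_dwalks)
  finally show ?thesis
    unfolding energy_def inprod_def dwalks_add
    by (simp add: sum_distrib_left sum.distrib[symmetric] algebra_simps)
qed

lemma energy_minus: "energy N n (\<lambda>x. - v x) = energy N n v"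
  using dwalks_cmult[of n N "-1" v] by (simp add: energy_def inprod_def)

lemma energy_le_sup:
  assumes "\<And>x. \<bar>v x\<bar> \<le> B"
  shows "energy N n v \<le> N * B\<^sup>2"
proof -
  have "energy N n v \<le> (\<Sum>x=1..N. B\<^sup>2)"
    unfolding energy_def inprod_def power2_eq_square[symmetric]
  proof (intro sum_mono)
    fix x
    have "\<bar>dwalks N n v x\<bar> \<le> \<bar>B\<bar>" using dwalks_sup[of v B n N x] assms by fastforce
    thus "(dwalks N n v x)\<^sup>2 \<le> B\<^sup>2" by (simp only: abs_le_square_iff)
  qed
  thus ?thesis by simp
qed

text \<open>As \<open>y \<ge> 1\<close>, the total mass is unchanged and the bridge changes by
  \<open>s\<close> times the unit mass at \<open>y\<close>. The quadratic term does not see the sign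
  \<open>s\<close>.\<close>

lemma energy_move:
  fixes G :: "nat \<Rightarrow> real" and n N :: nat and \<xi> :: "nat \<Rightarrow> nat"
  assumes "\<And>z. z \<le> N \<Longrightarrow> tailsum N \<zeta> z = tailsum N \<xi> z + s * of_bool (z = y)"
    "y \<in> {1..N}" "s = 1 \<or> s = -1"
  defines "u \<equiv> dwalks N (2 * n) (bridge N G \<xi>)"
  shows "energy N n (bridge N G \<zeta>) - energy N n (bridge N G \<xi>)
    = 2 * s * u y + energy N n (\<lambda>x. of_bool (x = y))"
proof -
  have "bridge N G \<zeta> = (\<lambda>x. bridge N G \<xi> x + s * of_bool (x = y))"
    using assms(1,2) by (auto simp: bridge_def deviation_def fun_eq_iff)
  moreover have "dirichlet N (\<lambda>x. s * of_bool (x = y))"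
    using assms(2) by (auto simp: dirichlet_def)
  ultimately have "energy N n (bridge N G \<zeta>) - energy N n (bridge N G \<xi>)
     = 2 * inprod N u (\<lambda>x. s * of_bool (x = y)) + energy N n (\<lambda>x. s * of_bool (x = y))"
    unfolding u_def by (simp add: energy_add)
  also have "energy N n (\<lambda>x. s * of_bool (x = y)) = energy N n (\<lambda>x. of_bool (x = y))"
    using assms(3) energy_minus[of N n "\<lambda>x. of_bool (x = y)"] by auto
  also have "inprod N u (\<lambda>x. s * of_bool (x = y)) = s * u y"
    using assms(2) by (simp only: inprod_cmult_right inprod_delta)
  finally show ?thesis by simp
qed

lemma sum_neighbours_le_tailsum:
  "(\<Sum>y=1..N. real (\<xi> (y - 1)) + real (\<xi> y)) \<le> 2 * tailsum N \<xi> 0"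
proof -
  have "(\<Sum>y=1..N. real (\<xi> (y - 1))) = (\<Sum>y<N. real (\<xi> y))" by (rule sum_shift_nat)
  also have "\<dots> \<le> tailsum N \<xi> 0" unfolding tailsum_def by (intro sum_mono2) auto
  finally have "(\<Sum>y=1..N. real (\<xi> (y - 1))) \<le> tailsum N \<xi> 0" .
  moreover have "(\<Sum>y=1..N. real (\<xi> y)) \<le> tailsum N \<xi> 0"
    unfolding tailsum_def by (intro sum_mono2) auto
  ultimately show ?thesis by (simp only: sum.distrib)
qed

text \<open>The first order terms of the two directions across a bond combine to the current
  \<open>\<xi> (y - 1) - \<xi> y\<close> paired with \<open>u\<close>. The second order terms are
  the noise: each is at most \<open>delta_bound n\<close> times a jump rate, and the rates sum to at
  most the number of particles.\<close>

lemma energy_bulk: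
  fixes G :: "nat \<Rightarrow> real" and n N :: nat and \<xi> :: "nat \<Rightarrow> nat"
  defines "u \<equiv> dwalks N (2 * n) (bridge N G \<xi>)"
  shows "(\<Sum>x<N. real (\<xi> x) / 2 * (energy N n (bridge N G (move \<xi> x (Suc x))) - energy N n (bridge N G \<xi>))
       + real (\<xi> (Suc x)) / 2 * (energy N n (bridge N G (move \<xi> (Suc x) x)) - energy N n (bridge N G \<xi>)))
     \<le> inprod N u (\<lambda>y. real (\<xi> (y - 1)) - real (\<xi> y)) + delta_bound n * tailsum N \<xi> 0"
    (is "(\<Sum>x<N. ?l x + ?r x) \<le> _")
proof -
  define q where "q y = energy N n (\<lambda>x. of_bool (x = y))" for y
  \<comment> \<open>On an empty site truncated subtraction makes \<open>move\<close> add a particle,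
    but the rate is then 0.\<close>
  have l: "?l x = real (\<xi> x) / 2 * (2 * u (Suc x) + q (Suc x))" if "x < N" for x
    using energy_move[of N "move \<xi> x (Suc x)" \<xi> 1 "Suc x" n G] tailsum_move_right[of x N \<xi>] that
    by (cases "\<xi> x = 0") (auto simp: u_def q_def)
  have r: "?r x = real (\<xi> (Suc x)) / 2 * (- 2 * u (Suc x) + q (Suc x))" if "x < N" for x
    using energy_move[of N "move \<xi> (Suc x) x" \<xi> "-1" "Suc x" n G] tailsum_move_left[of x N \<xi>] that
    by (cases "\<xi> (Suc x) = 0") (auto simp: u_def q_def)
  have "(\<Sum>x<N. ?l x + ?r x) = (\<Sum>x<N. real (\<xi> x) / 2 * (2 * u (Suc x) + q (Suc x))
      + real (\<xi> (Suc x)) / 2 * (- 2 * u (Suc x) + q (Suc x)))"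
    using l r by (intro sum.cong refl) (simp only: lessThan_iff)
  also have "\<dots> = (\<Sum>y=1..N. real (\<xi> (y - 1)) / 2 * (2 * u y + q y) + real (\<xi> y) / 2 * (- 2 * u y + q y))"
    unfolding sum_shift_nat[symmetric] by (intro sum.cong) auto
  also have "\<dots> = inprod N u (\<lambda>y. real (\<xi> (y - 1)) - real (\<xi> y)) + (\<Sum>y=1..N. q y * ((real (\<xi> (y - 1)) + real (\<xi> y)) / 2))"
    unfolding inprod_def sum.distrib[symmetric] by (intro sum.cong refl) (simp add: field_simps)
  also have "(\<Sum>y=1..N. q y * ((real (\<xi> (y - 1)) + real (\<xi> y)) / 2)) \<le> (\<Sum>y=1..N. delta_bound n * ((real (\<xi> (y - 1)) + real (\<xi> y)) / 2))"
    using dwalks_delta_energy[of _ N n] by (intro sum_mono mult_right_mono) (auto simp: q_def energy_def)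
  also have "\<dots> = delta_bound n * ((\<Sum>y=1..N. real (\<xi> (y - 1)) + real (\<xi> y)) / 2)"
    by (simp add: sum_distrib_left sum_divide_distrib)
  also have "\<dots> \<le> delta_bound n * tailsum N \<xi> 0"
    using sum_neighbours_le_tailsum[where N = N and \<xi> = \<xi>] by (intro mult_left_mono) (auto simp: delta_bound_def)
  finally show ?thesis by simp
qed

section \<open>Contraction of the energy towards a stationary profile\<close>

text \<open>\<open>G\<close> solves the stationary equation on the lattice with a relaxed removal
  rate: \<open>\<theta>\<close> replaces the indicator of \<open>G > 0\<close> and may be below 1
  only where \<open>G\<close> is at most \<open>j / N\<close>, that is, near the edge or beyond
  it.\<close>

locale profile =
  fixes j :: real and N :: nat and G \<theta> :: "nat \<Rightarrow> real"
  assumes j: "0 \<le> j" and N: "1 \<le> N"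
    and G_end: "G (N + 1) = 0"
    and G_bounds: "\<And>x. x \<in> {1..N} \<Longrightarrow> 0 \<le> G x \<and> G x \<le> G 0"
    and \<theta>_bounds: "\<And>x. x \<in> {1..N} \<Longrightarrow> 0 \<le> \<theta> x \<and> \<theta> x \<le> 1"
    and \<theta>_one: "\<And>x. x \<in> {1..N} \<Longrightarrow> \<theta> x = 1 \<or> G x \<le> j / N"
    and G_laplace: "\<And>x. x \<in> {1..N} \<Longrightarrow> G (x - 1) + G (x + 1) - 2 * G x = 2 * j / N * \<theta> x"
begin

abbreviation "D \<equiv> deviation N G"
abbreviation "f \<equiv> bridge N G"

lemma dwalk_bridge:
  assumes x: "x \<in> {1..N}"
  shows "2 * (dwalk N (f \<xi>) x - f \<xi> x) = real (\<xi> (x - 1)) - real (\<xi> x) - 2 * j / N * \<theta> x"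
proof -
  \<comment> \<open>The formula extends to \<open>0\<close> and \<open>N + 1\<close>: both sides
    vanish there, since \<open>hat\<close> is 1 and 0 and the deviation at \<open>N + 1\<close> is
    0.\<close>
  have f_eq: "f \<xi> y = D \<xi> y - D \<xi> 0 * hat N y" if "y \<le> N + 1" for y
  proof (cases "y \<in> {1..N}")
    case False
    hence "y = 0 \<or> y = N + 1" using that by auto
    thus ?thesis by (auto simp: bridge_def hat_def deviation_def G_end[simplified] tailsum_outside)
  qed (simp add: bridge_def)
  have "2 * (dwalk N (f \<xi>) x - f \<xi> x) = f \<xi> (x - 1) + f \<xi> (x + 1) - 2 * f \<xi> x"
    using x by (simp add: dwalk_def)
  also have "\<dots> = (D \<xi> (x - 1) + D \<xi> (x + 1) - 2 * D \<xi> x)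
      - D \<xi> 0 * (hat N (x - 1) + hat N (x + 1) - 2 * hat N x)"
  proof -
    have "x - 1 \<le> N + 1" "x + 1 \<le> N + 1" "x \<le> N + 1" using x by auto
    from this[THEN f_eq] show ?thesis by (simp add: algebra_simps)
  qed
  also have "hat N (x - 1) + hat N (x + 1) - 2 * hat N x = 0"
    using x by (simp add: hat_def of_nat_diff divide_simps)
  also have "D \<xi> (x - 1) + D \<xi> (x + 1) - 2 * D \<xi> x
      = (tailsum N \<xi> (x - 1) + tailsum N \<xi> (x + 1) - 2 * tailsum N \<xi> x) - 2 * j / N * \<theta> x"
    unfolding G_laplace[OF x, symmetric] by (simp add: deviation_def)
  also have "tailsum N \<xi> (x - 1) + tailsum N \<xi> (x + 1) - 2 * tailsum N \<xi> x = real (\<xi> (x - 1)) - real (\<xi> x)"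
    using x tailsum_rec[of "x - 1" N \<xi>] tailsum_rec[of x N \<xi>] by (simp add: le_diff_conv)
  finally show ?thesis by simp
qed

text \<open>With \<open>P = dwalk N\<close> and \<open>g = P^n (f \<xi>)\<close>, symmetry turns the
  pairing of \<open>u\<close> with \<open>P (f \<xi>) - f \<xi>\<close> into that of
  \<open>g\<close> with \<open>P g - g\<close>, which is nonpositive. By \<open>dwalk_bridge\<close>
  only the source \<open>\<theta>\<close> of the profile is left.\<close>

lemma inprod_current_le:
  fixes n :: nat and \<xi> :: "nat \<Rightarrow> nat"
  defines "u \<equiv> dwalks N (2 * n) (f \<xi>)"
  shows "inprod N u (\<lambda>y. real (\<xi> (y - 1)) - real (\<xi> y)) \<le> 2 * j / N * inprod N u \<theta>"
proof -
  define g where "g = dwalks N n (f \<xi>)"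
  have g: "dirichlet N g" by (simp add: g_def dirichlet_dwalks)
  have u: "u = dwalks N n g" by (simp add: u_def g_def mult_2 funpow_add)
  have "inprod N u (dwalk N (f \<xi>)) = inprod N g (dwalk N g)"
    unfolding u by (subst inprod_dwalks[OF g]) (simp_all add: g_def funpow_swap1)
  moreover have "inprod N u (f \<xi>) = inprod N g g"
    unfolding u by (subst inprod_dwalks[OF g]) (simp_all add: g_def)
  ultimately have A: "inprod N u (dwalk N (f \<xi>)) \<le> inprod N u (f \<xi>)"
    using inprod_dwalk_le[OF g] by (simp add: inprod_commute)
  have "inprod N u (\<lambda>y. real (\<xi> (y - 1)) - real (\<xi> y))
     = inprod N u (\<lambda>y. 2 * (dwalk N (f \<xi>) y - f \<xi> y) + 2 * j / N * \<theta> y)"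
    using dwalk_bridge[of _ \<xi>] by (intro inprod_cong) (metis diff_add_cancel)
  also have "\<dots> = 2 * (inprod N u (dwalk N (f \<xi>)) - inprod N u (f \<xi>)) + 2 * j / N * inprod N u \<theta>"
    by (simp only: inprod_add_right inprod_diff_right inprod_cmult_right)
  finally show ?thesis using A by simp
qed

text \<open>One step moves the bridge by half the difference of current and source, so by at most
  \<open>tailsum N \<xi> 0 + j\<close> in the l1 norm; the steps telescope.\<close>

lemma smoothing_error:
  "(\<Sum>x=1..N. \<bar>dwalks N n (f \<xi>) x - f \<xi> x\<bar>) \<le> n * (tailsum N \<xi> 0 + j)"
proof -
  have "2 * (\<Sum>x=1..N. \<bar>dwalk N (f \<xi>) x - f \<xi> x\<bar>)
     \<le> (\<Sum>x=1..N. (real (\<xi> (x - 1)) + real (\<xi> x)) + 2 * j / N)"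
    unfolding sum_distrib_left
  proof (intro sum_mono)
    fix x assume x: "x \<in> {1..N}"
    have "0 \<le> 2 * j / N * \<theta> x" using j \<theta>_bounds[OF x] by simp
    moreover have "2 * j / N * \<theta> x \<le> 2 * j / N"
      using j \<theta>_bounds[OF x] by (intro mult_left_le) auto
    ultimately show "2 * \<bar>dwalk N (f \<xi>) x - f \<xi> x\<bar> \<le> (real (\<xi> (x - 1)) + real (\<xi> x)) + 2 * j / N"
      using dwalk_bridge[OF x, of \<xi>] by linarith
  qed
  also have "\<dots> \<le> 2 * tailsum N \<xi> 0 + 2 * j"
    using N sum_neighbours_le_tailsum[where N = N and \<xi> = \<xi>] by (simp add: sum.distrib[of _ "\<lambda>_. 2 * j / N"])
  finally have "(\<Sum>x=1..N. \<bar>dwalk N (f \<xi>) x - f \<xi> x\<bar>) \<le> tailsum N \<xi> 0 + j" by simp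
  hence "n * (\<Sum>x=1..N. \<bar>dwalk N (f \<xi>) x - f \<xi> x\<bar>) \<le> n * (tailsum N \<xi> 0 + j)"
    by (intro mult_left_mono) auto
  with dwalks_diff_l1[OF dirichlet_bridge] show ?thesis by (rule order_trans)
qed

text \<open>The removal term acts monotonically: where the profile is positive one particle is
  removed at full rate, so the sign of the deviation opposes the difference of the rates.\<close>

lemma inprod_rates_le:
  fixes \<xi> :: "nat \<Rightarrow> nat"
  assumes "\<exists>y\<le>N. 0 < \<xi> y"
  defines "H \<equiv> \<lambda>x. of_bool (0 < tailsum N \<xi> x)"
  shows "inprod N (f \<xi>) (\<lambda>x. \<theta> x - H x) \<le> j + \<bar>D \<xi> 0\<bar> * N"
proof -
  have "inprod N (f \<xi>) (\<lambda>x. \<theta> x - H x) \<le> (\<Sum>x=1..N. j / N + \<bar>D \<xi> 0\<bar>)"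
    unfolding inprod_def
  proof (intro sum_mono)
    fix x assume x: "x \<in> {1..N}"
    have abs: "\<bar>\<theta> x - H x\<bar> \<le> 1" using \<theta>_bounds[OF x] by (auto simp: H_def)
    have "\<bar>D \<xi> 0 * hat N x * (\<theta> x - H x)\<bar> \<le> \<bar>D \<xi> 0\<bar> * 1 * 1"
      unfolding abs_mult using abs hat_bounds[of x N] x by (intro mult_mono) auto
    moreover have "D \<xi> x * (\<theta> x - H x) \<le> j / N"
    proof (cases "0 < tailsum N \<xi> x")
      case True
      show ?thesis
      proof (cases "D \<xi> x \<ge> 0 \<or> \<theta> x = 1")
        case True
        have "D \<xi> x * (\<theta> x - H x) \<le> 0"
          using True \<theta>_bounds[OF x] \<open>0 < tailsum N \<xi> x\<close> by (auto simp: H_def mult_nonneg_nonpos)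
        thus ?thesis using j by (smt (verit) divide_nonneg_nonneg of_nat_0_le_iff)
      next
        case False
        \<comment> \<open>Only here is the sign unfavourable: the tail sum lies below
          \<open>G\<close> and \<open>\<theta>\<close> below 1, but then
          \<open>G \<le> j / N\<close>. Summed over the sites this costs at most
          \<open>j\<close>.\<close>
        hence "- D \<xi> x \<le> j / N" using \<theta>_one[OF x] True by (auto simp: deviation_def)
        moreover have "D \<xi> x * (\<theta> x - H x) = (- D \<xi> x) * (1 - \<theta> x)" using True by (simp add: H_def algebra_simps)
        moreover have "\<dots> \<le> (- D \<xi> x) * 1" using False \<theta>_bounds[OF x] by (intro mult_left_mono) auto
        ultimately show ?thesis by simp
      qed
    next
      case False
      hence "D \<xi> x = - G x" using tailsum_nonneg[of N \<xi> x] by (simp add: deviation_def)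
      hence "D \<xi> x * (\<theta> x - H x) \<le> 0" using False \<theta>_bounds[OF x] G_bounds[OF x] by (simp add: H_def)
      thus ?thesis using j by (smt (verit) divide_nonneg_nonneg of_nat_0_le_iff)
    qed
    ultimately show "f \<xi> x * (\<theta> x - H x) \<le> j / N + \<bar>D \<xi> 0\<bar>"
      using x by (simp add: bridge_def left_diff_distrib)
  qed
  thus ?thesis using N by (simp add: distrib_left mult.commute)
qed

text \<open>The linear terms of bulk, birth and death add up to at most \<open>2 * j / N\<close>
  times the pairing of the smoothed bridge \<open>u\<close> with \<open>\<theta> - H\<close>, where
  \<open>H\<close> indicates positive tail sums. Trading \<open>u\<close> for the bridge costs the
  smoothing error of \<open>2 * n\<close> steps, and monotonicity bounds the rest. The squared terms
  of birth and death have rate \<open>j / N\<close> and energy at most \<open>N\<close>, whence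
  \<open>2 * j\<close>.\<close>

lemma gen_energy_le:
  "gen j N (\<lambda>\<xi>. energy N n (f \<xi>)) \<xi>
     \<le> 2 * j / N * (j + \<bar>D \<xi> 0\<bar> * N + 2 * real n * (tailsum N \<xi> 0 + j))
       + delta_bound n * tailsum N \<xi> 0 + 2 * j"
proof -
  define u where "u = dwalks N (2 * n) (f \<xi>)"
  define c where "c x = (if x \<in> {1..N} then hat N x else 0)" for x
  define H :: "nat \<Rightarrow> real" where "H x = of_bool (0 < tailsum N \<xi> x)" for x
  define bulk where "bulk = (\<Sum>x<N. real (\<xi> x) / 2 * (energy N n (f (move \<xi> x (Suc x))) - energy N n (f \<xi>))
       + real (\<xi> (Suc x)) / 2 * (energy N n (f (move \<xi> (Suc x) x)) - energy N n (f \<xi>)))"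
  have c: "dirichlet N c" "\<bar>c x\<bar> \<le> 1" for x
    using hat_bounds[of x N] by (auto simp: dirichlet_def c_def)
  have sup1: "energy N n v \<le> N" if "\<And>x. \<bar>v x\<bar> \<le> 1" for v
    using energy_le_sup[of v 1 N n] that by simp
  have c': "dirichlet N (\<lambda>x. - c x)" using c by (simp add: dirichlet_def)
  \<comment> \<open>A birth raises only the tail sum at \<open>0\<close>, so the bridge changes by
    minus \<open>hat\<close>.\<close>
  have "f (\<xi>(0 := Suc (\<xi> 0))) = (\<lambda>x. f \<xi> x + - c x)"
    by (auto simp: fun_eq_iff bridge_def deviation_def c_def tailsum_birth left_diff_distrib distrib_right)
  hence "energy N n (f (\<xi>(0 := Suc (\<xi> 0)))) = energy N n (f \<xi>) + 2 * inprod N u (\<lambda>x. - c x) + energy N n c"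
    by (simp only: u_def energy_add[OF dirichlet_bridge c'] energy_minus)
  hence "energy N n (f (\<xi>(0 := Suc (\<xi> 0)))) - energy N n (f \<xi>) = - 2 * inprod N u c + energy N n c"
    using inprod_cmult_right[of N u "-1" c] by simp
  also have "\<dots> \<le> - 2 * inprod N u c + N" using sup1[of c] c by simp
  finally have birth: "j / N * (energy N n (f (\<xi>(0 := Suc (\<xi> 0)))) - energy N n (f \<xi>))
     \<le> j / N * (- 2 * inprod N u c + N)"
    using j by (intro mult_left_mono) auto
  show ?thesis
  proof (cases "\<exists>y\<le>N. 0 < \<xi> y")
    case True
    define v where "v x = (if x \<in> {1..N} then hat N x - H x else 0)" for x
    have v: "dirichlet N v" "\<bar>v x\<bar> \<le> 1" for x
      using hat_bounds[of x N] by (auto simp: dirichlet_def v_def H_def)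
    have "0 < tailsum N \<xi> 0" using True by (simp add: tailsum_pos_iff)
    hence "f (\<xi>(rightmost N \<xi> := \<xi> (rightmost N \<xi>) - Suc 0)) = (\<lambda>x. f \<xi> x + v x)"
      by (auto simp: fun_eq_iff bridge_def deviation_def v_def H_def tailsum_death[OF True] left_diff_distrib)
    hence "energy N n (f (\<xi>(rightmost N \<xi> := \<xi> (rightmost N \<xi>) - Suc 0))) - energy N n (f \<xi>)
        = 2 * inprod N u v + energy N n v"
      by (simp add: u_def energy_add[OF dirichlet_bridge v(1)])
    also have "inprod N u v = inprod N u (\<lambda>x. c x - H x)"
      by (intro inprod_cong) (simp add: v_def c_def)
    also have "\<dots> = inprod N u c - inprod N u H" by (rule inprod_diff_right)
    also have "2 * \<dots> + energy N n v \<le> 2 * (inprod N u c - inprod N u H) + N"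
      using sup1[of v] v by simp
    finally have *: "energy N n (f (\<xi>(rightmost N \<xi> := \<xi> (rightmost N \<xi>) - Suc 0))) - energy N n (f \<xi>)
      \<le> 2 * (inprod N u c - inprod N u H) + N" .
    have death: "j / N * (energy N n (f (\<xi>(rightmost N \<xi> := \<xi> (rightmost N \<xi>) - Suc 0))) - energy N n (f \<xi>))
      \<le> j / N * (2 * (inprod N u c - inprod N u H) + N)"
      using j by (intro mult_left_mono *) auto
    have "gen j N (\<lambda>\<xi>. energy N n (f \<xi>)) \<xi> = bulk
       + j / N * (energy N n (f (\<xi>(0 := Suc (\<xi> 0)))) - energy N n (f \<xi>))
       + j / N * (energy N n (f (\<xi>(rightmost N \<xi> := \<xi> (rightmost N \<xi>) - Suc 0))) - energy N n (f \<xi>))"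
      unfolding gen_eq if_P[OF True] bulk_def by (rule refl)
    moreover have "bulk \<le> 2 * j / N * inprod N u \<theta> + delta_bound n * tailsum N \<xi> 0"
      using energy_bulk[where N = N and \<xi> = \<xi> and n = n and G = G] inprod_current_le[where n = n and \<xi> = \<xi>] unfolding bulk_def u_def by linarith
    \<comment> \<open>The \<open>hat\<close> contributions of birth and death cancel.\<close>
    moreover have "2 * j / N * inprod N u \<theta> + j / N * (- 2 * inprod N u c + N)
       + j / N * (2 * (inprod N u c - inprod N u H) + N) = 2 * j / N * (inprod N u \<theta> - inprod N u H) + 2 * j"
      using N by (simp add: field_simps)
    ultimately have le: "gen j N (\<lambda>\<xi>. energy N n (f \<xi>)) \<xi>
       \<le> 2 * j / N * (inprod N u \<theta> - inprod N u H) + delta_bound n * tailsum N \<xi> 0 + 2 * j"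
      using birth death by linarith
    have "inprod N u \<theta> - inprod N u H = inprod N u (\<lambda>x. \<theta> x - H x)"
      by (rule inprod_diff_right[symmetric])
    also have "\<dots> = inprod N (f \<xi>) (\<lambda>x. \<theta> x - H x) + inprod N (\<lambda>x. u x - f \<xi> x) (\<lambda>x. \<theta> x - H x)"
      by (simp add: inprod_def sum.distrib[symmetric] algebra_simps)
    also have "\<dots> \<le> (j + \<bar>D \<xi> 0\<bar> * N) + 2 * real n * (tailsum N \<xi> 0 + j)"
    proof (intro add_mono)
      show "inprod N (f \<xi>) (\<lambda>x. \<theta> x - H x) \<le> j + \<bar>D \<xi> 0\<bar> * N"
        using inprod_rates_le[OF True] by (simp add: H_def)
      have "\<bar>inprod N (\<lambda>x. u x - f \<xi> x) (\<lambda>x. \<theta> x - H x)\<bar> \<le> (\<Sum>x=1..N. \<bar>u x - f \<xi> x\<bar>)"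
      proof (intro inprod_le_l1)
        fix x assume "x \<in> {1..N}"
        thus "\<bar>\<theta> x - H x\<bar> \<le> 1" using \<theta>_bounds[of x] by (auto simp: H_def)
      qed
      also have "\<dots> \<le> (2 * real n) * (tailsum N \<xi> 0 + j)"
        using smoothing_error[of "2 * n" \<xi>] by (simp add: u_def)
      finally show "inprod N (\<lambda>x. u x - f \<xi> x) (\<lambda>x. \<theta> x - H x) \<le> 2 * real n * (tailsum N \<xi> 0 + j)" by simp
    qed
    finally have "2 * j / N * (inprod N u \<theta> - inprod N u H)
       \<le> 2 * j / N * (j + \<bar>D \<xi> 0\<bar> * N + 2 * real n * (tailsum N \<xi> 0 + j))"
      using j by (intro mult_left_mono) auto
    thus ?thesis using le by linarith
  next
    \<comment> \<open>Without deaths the \<open>hat\<close> term of the births is not cancelled. In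
      the empty configuration, however, the bridge is explicit, \<open>G 0 * hat N x - G x\<close>,
      and bounded by \<open>G 0 = \<bar>D \<xi> 0\<bar>\<close>.\<close>
    case False
    hence zero: "\<xi> y = 0" if "y \<le> N" for y using that by auto
    have F: "tailsum N \<xi> x = 0" for x using zero by (simp add: tailsum_def)
    have "gen j N (\<lambda>\<xi>. energy N n (f \<xi>)) \<xi> \<le> j / N * (- 2 * inprod N u c + N)"
      unfolding gen_eq if_not_P[OF False] using birth zero by simp
    also have "\<dots> \<le> j / N * (2 * (\<bar>D \<xi> 0\<bar> * N) + N)"
    proof (intro mult_left_mono add_mono)
      have "\<bar>inprod N u c\<bar> \<le> (\<Sum>x=1..N. \<bar>u x\<bar>)" using c by (intro inprod_le_l1)
      also have "\<dots> \<le> (\<Sum>x=1..N. \<bar>f \<xi> x\<bar>)" unfolding u_def by (intro dwalks_l1) simp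
      also have "\<dots> \<le> (\<Sum>x=1..N. \<bar>D \<xi> 0\<bar>)"
      proof (intro sum_mono)
        fix x assume x: "x \<in> {1..N}"
        have "0 \<le> G 0 * hat N x" "G 0 * hat N x \<le> G 0"
          using hat_bounds[of x N] G_bounds[OF x] x by (auto intro!: mult_left_le mult_nonneg_nonneg)
        thus "\<bar>f \<xi> x\<bar> \<le> \<bar>D \<xi> 0\<bar>" using x G_bounds[OF x] by (auto simp: bridge_def deviation_def F)
      qed
      finally show "- 2 * inprod N u c \<le> 2 * (\<bar>D \<xi> 0\<bar> * N)" by (simp add: mult.commute)
    qed (use j in auto)
    also have "\<dots> = 2 * j / N * (\<bar>D \<xi> 0\<bar> * N) + j" using N by (simp add: field_simps)
    also have "\<dots> \<le> 2 * j / N * (j + \<bar>D \<xi> 0\<bar> * N + 2 * real n * (tailsum N \<xi> 0 + j)) + delta_bound n * tailsum N \<xi> 0 + 2 * j"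
    proof -
      have "2 * j / N * (\<bar>D \<xi> 0\<bar> * N) \<le> 2 * j / N * (j + \<bar>D \<xi> 0\<bar> * N + 2 * real n * (tailsum N \<xi> 0 + j))"
        using j F by (intro mult_left_mono) auto
      thus ?thesis using j by (simp add: F)
    qed
    finally show ?thesis .
  qed
qed

text \<open>The total mass is a random walk with rate \<open>j / N\<close> up and down. At zero mass
  only births occur, but there \<open>D \<xi> 0 \<le> 0\<close>, so their drift is
  favourable.\<close>

lemma gen_mass_le: "gen j N (\<lambda>\<xi>. (D \<xi> 0)\<^sup>2) \<xi> \<le> 2 * j / N"
proof -
  have r: "real (\<xi> x) * ((D (move \<xi> x (Suc x)) 0)\<^sup>2 - (D \<xi> 0)\<^sup>2) = 0" if "x < N" for x
    using tailsum_move_right[OF that, of \<xi>] by (cases "\<xi> x = 0") (auto simp: deviation_def)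
  have l: "real (\<xi> (Suc x)) * ((D (move \<xi> (Suc x) x) 0)\<^sup>2 - (D \<xi> 0)\<^sup>2) = 0" if "x < N" for x
    using tailsum_move_left[OF that, of \<xi>] by (cases "\<xi> (Suc x) = 0") (auto simp: deviation_def)
  have bulk: "(\<Sum>x<N. real (\<xi> x) / 2 * ((D (move \<xi> x (Suc x)) 0)\<^sup>2 - (D \<xi> 0)\<^sup>2)
       + real (\<xi> (Suc x)) / 2 * ((D (move \<xi> (Suc x) x) 0)\<^sup>2 - (D \<xi> 0)\<^sup>2)) = 0"
    by (intro sum.neutral ballI) (simp only: lessThan_iff times_divide_eq_left l r div_0 add_0)
  have birth: "(D (\<xi>(0 := Suc (\<xi> 0))) 0)\<^sup>2 - (D \<xi> 0)\<^sup>2 = 2 * D \<xi> 0 + 1"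
    by (simp add: deviation_def tailsum_birth power2_eq_square algebra_simps)
  show ?thesis
  proof (cases "\<exists>y\<le>N. 0 < \<xi> y")
    case True
    hence "0 < tailsum N \<xi> 0" by (simp add: tailsum_pos_iff)
    hence eq: "(D (\<xi>(rightmost N \<xi> := \<xi> (rightmost N \<xi>) - Suc 0)) 0)\<^sup>2 - (D \<xi> 0)\<^sup>2 = - 2 * D \<xi> 0 + 1"
      by (simp add: deviation_def tailsum_death[OF True] power2_eq_square algebra_simps)
    thus ?thesis unfolding gen_eq if_P[OF True] bulk birth eq by (simp add: algebra_simps)
  next
    case False
    hence "tailsum N \<xi> 0 = 0" by (auto simp: tailsum_def)
    hence "D \<xi> 0 \<le> 0" using G_bounds[of 1] N by (auto simp: deviation_def)
    hence "j / N * (2 * D \<xi> 0 + 1) \<le> j / N * 2" using j by (intro mult_left_mono) auto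
    thus ?thesis unfolding gen_eq if_not_P[OF False] bulk birth by simp
  qed
qed

end

section \<open>The Lyapunov function\<close>

context profile
begin

text \<open>The factor \<open>2 * j + 4 * j * real n + 1\<close> is the coefficient of
  \<open>\<bar>D \<xi> 0\<bar>\<close> in the bound for the generator. The last summand is
  \<open>N^2\<close> times the part of the bound independent of \<open>\<xi>\<close>, since the
  generator is compared with \<open>lyapunov / N^2\<close>. For fixed \<open>n\<close> its only term
  of order \<open>N^3\<close> carries the small factor \<open>delta_bound n\<close>.\<close>

definition lyapunov :: "real \<Rightarrow> nat \<Rightarrow> (nat \<Rightarrow> nat) \<Rightarrow> real" where
  "lyapunov M n \<xi> = energy N n (f \<xi>) + (2 * j + 4 * j * real n + 1) * (N * sqrt N) * (D \<xi> 0)\<^sup>2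
     + (real N)\<^sup>2 * (2 * j\<^sup>2 * (1 + 2 * real n) + 2 * j + 16 * j * real n * M + 4 * M * delta_bound n * N
        + (2 * j + 4 * j * real n + 1) * (1 + 2 * j) * sqrt N)"

lemma lyapunov_ge:
  fixes M :: real
  assumes "0 \<le> M"
  shows "energy N n (f \<xi>) \<le> lyapunov M n \<xi>" "N * sqrt N * (D \<xi> 0)\<^sup>2 \<le> lyapunov M n \<xi>"
proof -
  define C where "C = (2 * j + 4 * j * real n + 1)"
  have C: "1 \<le> C" using j by (simp add: C_def)
  have K: "0 \<le> (real N)\<^sup>2 * (2 * j\<^sup>2 * (1 + 2 * real n) + 2 * j + 16 * j * real n * M + 4 * M * delta_bound n * N
        + C * (1 + 2 * j) * sqrt N)"
    using j assms C by (auto simp: delta_bound_def intro!: mult_nonneg_nonneg add_nonneg_nonneg)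
  have "1 * (N * sqrt N * (D \<xi> 0)\<^sup>2) \<le> C * (N * sqrt N * (D \<xi> 0)\<^sup>2)"
    using C by (intro mult_right_mono) auto
  hence A: "N * sqrt N * (D \<xi> 0)\<^sup>2 \<le> C * (N * sqrt N) * (D \<xi> 0)\<^sup>2" by (simp add: mult_ac)
  moreover have "0 \<le> N * sqrt N * (D \<xi> 0)\<^sup>2" by simp
  ultimately show "energy N n (f \<xi>) \<le> lyapunov M n \<xi>" "N * sqrt N * (D \<xi> 0)\<^sup>2 \<le> lyapunov M n \<xi>"
    using K energy_nonneg[of N n "f \<xi>"] unfolding lyapunov_def C_def[symmetric] by linarith+
qed

lemma delta_bound_le_1: "delta_bound n \<le> 1"
proof -
  have "real (n choose (n div 2)) \<le> real (2 ^ n)"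
    by (intro of_nat_mono binomial_le_pow2)
  thus ?thesis by (simp add: delta_bound_def)
qed

lemma gen_lyapunov_le:
  fixes M :: real
  assumes M: "0 \<le> M" and G0: "G 0 \<le> 4 * M * N"
  shows "gen j N (lyapunov M n) \<xi> \<le> 1 / (real N)\<^sup>2 * lyapunov M n \<xi>"
proof -
  define C where "C = 2 * j + 4 * j * real n + 1"
  define q where "q = sqrt N"
  define d where "d = \<bar>D \<xi> 0\<bar>"
  define c where "c = delta_bound n"
  define F where "F = tailsum N \<xi> 0"
  define C0 where "C0 = 2 * j\<^sup>2 * (1 + 2 * real n) + 2 * j + 16 * j * real n * M"
  have N1: "1 \<le> real N" using N by simp
  have q: "q * q = N" "0 < q" using N by (auto simp: q_def)
  have c: "0 \<le> c" "c \<le> 1" using delta_bound_le_1 by (auto simp: c_def delta_bound_def)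
  have d: "0 \<le> d" by (simp add: d_def)
  have C: "0 \<le> C" using j by (simp add: C_def)
  have F: "F \<le> 4 * M * N + d" using G0 by (auto simp: F_def d_def deviation_def)
  have lyap: "lyapunov M n = (\<lambda>\<xi>. energy N n (f \<xi>) + C * (N * q) * (D \<xi> 0)\<^sup>2
     + (real N)\<^sup>2 * (C0 + 4 * M * c * N + C * (1 + 2 * j) * q))"
    by (simp add: lyapunov_def C_def q_def c_def C0_def fun_eq_iff)
  have "gen j N (lyapunov M n) \<xi> = gen j N (\<lambda>\<xi>. energy N n (f \<xi>)) \<xi> + C * (N * q) * gen j N (\<lambda>\<xi>. (D \<xi> 0)\<^sup>2) \<xi>"
    unfolding lyap by (simp only: gen_add gen_cmult gen_const) simp
  also have "\<dots> \<le> (2 * j / N * (j + d * N + 2 * n * (F + j)) + c * F + 2 * j) + C * (N * q) * (2 * j / N)"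
    using gen_energy_le[of n \<xi>] gen_mass_le[of \<xi>] C q(2) unfolding d_def c_def F_def
    by (intro add_mono mult_left_mono) auto
  also have "C * (N * q) * (2 * j / N) = C * (2 * j) * q" using N by simp
  also have "2 * j / N * (j + d * N + 2 * n * (F + j)) = 2 * j\<^sup>2 * (1 + 2 * real n) / N + 2 * j * d + 4 * j * real n * (F / N)"
    using N by (simp add: field_simps power2_eq_square)
  finally have "gen j N (lyapunov M n) \<xi>
     \<le> 2 * j\<^sup>2 * (1 + 2 * real n) / N + 2 * j * d + 4 * j * real n * (F / N) + c * F + 2 * j + C * (2 * j) * q"
    by linarith
  moreover have "2 * j\<^sup>2 * (1 + 2 * real n) / N \<le> 2 * j\<^sup>2 * (1 + 2 * real n)"
    using divide_left_mono[OF N1, of "2 * j\<^sup>2 * (1 + 2 * real n)"] N1 by simp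
  moreover have "4 * j * real n * (F / N) \<le> 4 * j * real n * (4 * M + d)"
  proof (intro mult_left_mono)
    have "F / N \<le> (4 * M * N + d) / N" by (intro divide_right_mono F) simp
    also have "\<dots> = 4 * M + d / N" using N by (simp add: field_simps)
    also have "d / N \<le> d" using divide_left_mono[OF N1, of d] N1 d by simp
    finally show "F / N \<le> 4 * M + d" by simp
  qed (use j in auto)
  moreover have "c * F \<le> 4 * M * c * N + d"
  proof -
    have "c * F \<le> c * (4 * M * N + d)" by (intro mult_left_mono F c)
    moreover have "c * d \<le> 1 * d" by (intro mult_right_mono c d)
    ultimately show ?thesis by (simp add: algebra_simps)
  qed
  moreover have "C0 + C * d + 4 * M * c * N
     = 2 * j\<^sup>2 * (1 + 2 * real n) + 2 * j * d + 4 * j * real n * (4 * M + d) + (4 * M * c * N + d) + 2 * j"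
    by (simp add: C0_def C_def algebra_simps)
  ultimately have le: "gen j N (lyapunov M n) \<xi> \<le> C0 + C * d + 4 * M * c * N + C * (2 * j) * q" by linarith
  \<comment> \<open>Young's inequality at scale \<open>q = sqrt N\<close>: the weight
    \<open>N powr (3/2)\<close> divided by \<open>N^2\<close> leaves exactly \<open>d^2 / q\<close>,
    while the remainder \<open>q\<close> is of lower order than \<open>N\<close>.\<close>
  have "d \<le> d\<^sup>2 / q + q"
  proof (cases "d \<le> q")
    case True
    moreover have "0 \<le> d\<^sup>2 / q" using q by simp
    ultimately show ?thesis by linarith
  next
    case False
    hence "d * q \<le> d\<^sup>2" using q by (simp add: power2_eq_square)
    thus ?thesis using q by (simp add: field_simps)
  qed
  from mult_left_mono[OF this C] have "C * d \<le> C * (d\<^sup>2 / q) + C * q" by (simp add: algebra_simps)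
  moreover have "1 / (real N)\<^sup>2 * lyapunov M n \<xi>
      = energy N n (f \<xi>) / (real N)\<^sup>2 + C * (d\<^sup>2 / q) + (C0 + 4 * M * c * N + C * (1 + 2 * j) * q)"
  proof -
    have "1 / (real N)\<^sup>2 * (C * (N * q) * d\<^sup>2) = C * (d\<^sup>2 / q)"
      unfolding q(1)[symmetric] using q(2) by (simp add: field_simps power2_eq_square)
    moreover have "d\<^sup>2 = (D \<xi> 0)\<^sup>2" by (simp add: d_def)
    ultimately show ?thesis unfolding lyap using N by (simp add: distrib_left)
  qed
  moreover have "0 \<le> energy N n (f \<xi>) / (real N)\<^sup>2" using energy_nonneg by simp
  ultimately show ?thesis using le by (simp add: algebra_simps)
qed

lemma lyapunov_close:
  fixes B M :: real
  assumes "\<And>x. x \<le> N \<Longrightarrow> \<bar>D \<xi> x\<bar> \<le> B"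
  shows "lyapunov M n \<xi> \<le> N * (2 * B)\<^sup>2 + (2 * j + 4 * j * real n + 1) * (N * sqrt N) * B\<^sup>2
     + (real N)\<^sup>2 * (2 * j\<^sup>2 * (1 + 2 * real n) + 2 * j + 16 * j * real n * M + 4 * M * delta_bound n * N
        + (2 * j + 4 * j * real n + 1) * (1 + 2 * j) * sqrt N)"
proof -
  have B: "\<bar>D \<xi> 0\<bar> \<le> B" using assms[of 0] by simp
  have "\<bar>f \<xi> x\<bar> \<le> 2 * B" for x
  proof (cases "x \<in> {1..N}")
    case True
    have "\<bar>D \<xi> 0 * hat N x\<bar> \<le> B * 1"
      unfolding abs_mult using B hat_bounds[of x N] True by (intro mult_mono) auto
    moreover have "\<bar>D \<xi> x\<bar> \<le> B" using True by (intro assms) auto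
    ultimately show ?thesis using True by (simp add: bridge_def)
  qed (use B in \<open>auto simp: bridge_def\<close>)
  hence "energy N n (f \<xi>) \<le> N * (2 * B)\<^sup>2" by (rule energy_le_sup)
  moreover have "(D \<xi> 0)\<^sup>2 \<le> B\<^sup>2" using B by (subst abs_le_square_iff[symmetric]) auto
  hence "(2 * j + 4 * j * real n + 1) * (N * sqrt N) * (D \<xi> 0)\<^sup>2 \<le> (2 * j + 4 * j * real n + 1) * (N * sqrt N) * B\<^sup>2"
    using j by (intro mult_left_mono) auto
  ultimately show ?thesis unfolding lyapunov_def by linarith
qed

text \<open>If \<open>\<bar>D \<xi> 0\<bar>\<close> exceeds \<open>w * N\<close>, the weighted
  square alone is large enough. Otherwise the linear correction takes at most \<open>w * N\<close>
  of the gap \<open>2 * w * N\<close>, so the bridge keeps one sign and size \<open>w * N\<close> on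
  the window, and so does its smoothing at points at least \<open>n\<close> inside.\<close>

lemma lyapunov_window_ge:
  fixes s w r \<delta> M :: real
  assumes M: "0 \<le> M" and s: "\<bar>s\<bar> = 1" and w: "0 \<le> w"
    and \<delta>: "0 \<le> \<delta>" "\<delta> \<le> 1" "0 < r - \<delta>" "r + \<delta> < 1"
    and large: "2 * real n + 1 \<le> \<delta> * N"
    and window: "\<And>x. \<bar>real x - r * N\<bar> \<le> \<delta> * N \<Longrightarrow> 2 * w * N \<le> s * D \<xi> x"
  shows "\<delta> * w\<^sup>2 * real N ^ 3 \<le> lyapunov M n \<xi>"
proof (cases "\<bar>D \<xi> 0\<bar> \<le> w * N")
  case False
  have "1 \<le> sqrt N" using N by simp
  have "\<delta> * (w\<^sup>2 * real N ^ 3) \<le> 1 * (w\<^sup>2 * real N ^ 3)"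
    using \<delta> by (intro mult_right_mono) auto
  hence "\<delta> * w\<^sup>2 * real N ^ 3 \<le> 1 * (w * N)\<^sup>2 * N"
    by (simp add: power3_eq_cube power2_eq_square mult_ac)
  also have "\<dots> \<le> sqrt N * \<bar>D \<xi> 0\<bar>\<^sup>2 * N"
    using False w \<open>1 \<le> sqrt N\<close> by (intro mult_mono power_mono) auto
  also have "\<dots> \<le> lyapunov M n \<xi>" using lyapunov_ge(2)[OF M, where n = n and \<xi> = \<xi>] by (simp add: mult_ac)
  finally show ?thesis .
next
  case True
  define l where "l = (r - \<delta>) * N + n"
  define u where "u = (r + \<delta>) * N - n"
  define I where "I = {nat \<lceil>l\<rceil>..nat \<lfloor>u\<rfloor>}"
  have rN: "r * N - \<delta> * N > 0" "r * N + \<delta> * N < N"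
    using \<delta> N by (simp_all add: left_diff_distrib[symmetric] distrib_right[symmetric])
  have l: "l = r * N - \<delta> * N + n" and u: "u = r * N + \<delta> * N - n"
    by (simp_all add: l_def u_def algebra_simps)
  have lu: "0 < l" "l \<le> u" "u < N" using rN large l u by linarith+
  have I: "l \<le> x" "x \<le> u" if "x \<in> I" for x
    using that lu unfolding I_def by (auto simp: nat_le_iff le_nat_iff le_floor_iff ceiling_le_iff)
  have I_sub: "I \<subseteq> {1..N}" using I lu by force
  \<comment> \<open>The window shrunk by \<open>n\<close> on both sides has length
    \<open>2 * \<delta> * N - 2 * n\<close>, so \<open>2 * n + 1 \<le> \<delta> * N\<close> leaves
    at least \<open>\<delta> * N\<close> sites.\<close>
  have "u - l - 1 \<le> real (nat \<lfloor>u\<rfloor>) + 1 - real (nat \<lceil>l\<rceil>)" using lu by linarith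
  also have "\<dots> \<le> card I" by (simp add: I_def)
  finally have card: "\<delta> * N \<le> card I" using large l u by linarith
  have f: "w * N \<le> s * f \<xi> y" if y: "\<bar>real y - r * N\<bar> \<le> \<delta> * N" for y
  proof -
    have "0 < real y" "real y < real N" using y rN by linarith+
    hence yN: "y \<in> {1..N}" by auto
    have "\<bar>s * (D \<xi> 0 * hat N y)\<bar> \<le> 1 * (w * N * 1)"
      unfolding abs_mult using s True hat_bounds[of y N] yN by (intro mult_mono) auto
    thus ?thesis using window[OF y] yN by (simp add: bridge_def right_diff_distrib)
  qed
  have "(w * N)\<^sup>2 \<le> dwalks N n (f \<xi>) x * dwalks N n (f \<xi>) x" if x: "x \<in> I" for x
  proof -
    have nx: "n < x" "x + n \<le> N" using I[OF x] rN l u by linarith+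
    have "w * N \<le> dwalks N n (\<lambda>y. s * f \<xi> y) x"
    proof (rule dwalks_ge)
      fix y assume "x \<le> y + n" "y \<le> x + n"
      hence "\<bar>real y - real x\<bar> \<le> n" by linarith
      thus "w * N \<le> s * f \<xi> y" using I[OF x] l u by (intro f) linarith
    qed (use nx in auto)
    hence "w * N \<le> \<bar>s * dwalks N n (f \<xi>) x\<bar>" by (simp add: dwalks_cmult)
    hence "w * N \<le> \<bar>dwalks N n (f \<xi>) x\<bar>" using s by (simp add: abs_mult)
    from power_mono[OF this, of 2] show ?thesis using w by (simp add: power2_eq_square)
  qed
  hence "(\<Sum>x\<in>I. (w * N)\<^sup>2) \<le> (\<Sum>x\<in>I. dwalks N n (f \<xi>) x * dwalks N n (f \<xi>) x)" by (intro sum_mono)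
  also have "\<dots> \<le> energy N n (f \<xi>)" unfolding energy_def inprod_def using I_sub by (intro sum_mono2) auto
  finally have "card I * (w * N)\<^sup>2 \<le> energy N n (f \<xi>)" by simp
  moreover have "\<delta> * N * (w * N)\<^sup>2 \<le> card I * (w * N)\<^sup>2" using card by (intro mult_right_mono) auto
  moreover have "\<delta> * N * (w * N)\<^sup>2 = \<delta> * w\<^sup>2 * real N ^ 3" by (simp add: power2_eq_square power3_eq_cube)
  ultimately show ?thesis using lyapunov_ge(1)[OF M, where n = n and \<xi> = \<xi>] by linarith
qed

end

subsection \<open>Linear profiles and approximating configurations\<close>

text \<open>The closed form of the integral of \<open>rhoM j M\<close> over \<open>{r..1}\<close>,
  continued by 0 beyond 1.\<close>

definition tail_mass :: "real \<Rightarrow> real \<Rightarrow> real \<Rightarrow> real" where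
  "tail_mass j M r =
     (if M < j then j * (max 0 (sqrt (M / j) - r))\<^sup>2 else max 0 (1 - r) * (M - j * r))"

locale mass =
  fixes j M :: real
  assumes j: "0 < j" and M: "0 \<le> M"
begin

abbreviation "V \<equiv> tail_mass j M"

lemma tail_mass_0: "V 0 = M"
  using j M by (simp add: tail_mass_def)

lemma tail_mass_nonneg: "0 \<le> V r"
proof (cases "M < j \<or> 1 \<le> r")
  case False
  hence "j * r \<le> j * 1" using j by (intro mult_left_mono) auto
  thus ?thesis using False by (auto simp: tail_mass_def intro!: mult_nonneg_nonneg)
qed (use j in \<open>auto simp: tail_mass_def\<close>)

lemma edge_lt_1: "M < j \<Longrightarrow> sqrt (M / j) < 1"
  using j M by (simp add: real_sqrt_lt_1_iff)

lemma tail_mass_ge_1: "1 \<le> r \<Longrightarrow> V r = 0"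
proof (cases "M < j")
  case True
  assume "1 \<le> r"
  hence "max 0 (sqrt (M / j) - r) = 0" using edge_lt_1[OF True] by linarith
  thus ?thesis using True by (simp add: tail_mass_def)
qed (simp add: tail_mass_def)

lemma tail_mass_antimono:
  assumes "r \<le> s"
  shows "V s \<le> V r"
proof (cases "M < j \<or> 1 \<le> s")
  case True
  show ?thesis
  proof (cases "M < j")
    case True
    have "(max 0 (sqrt (M / j) - s))\<^sup>2 \<le> (max 0 (sqrt (M / j) - r))\<^sup>2"
      using assms by (intro power_mono) auto
    thus ?thesis using True j by (simp add: tail_mass_def)
  qed (use True tail_mass_ge_1[of s] tail_mass_nonneg[of r] in auto)
next
  case False
  hence "j * s \<le> j * 1" "j * r \<le> j * s" using j assms by (auto intro: mult_left_mono)
  hence "(1 - s) * (M - j * s) \<le> (1 - r) * (M - j * r)"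
    using False assms by (intro mult_mono) auto
  thus ?thesis using False assms by (simp add: tail_mass_def)
qed

text \<open>Past the right end \<open>rhoM\<close> is extended by its linear formula while the tail mass is cut
  off; the blocks of the approximation may reach one lattice spacing beyond \<open>1\<close>.\<close>

definition tail_mass_ext :: "real \<Rightarrow> real" where
  "tail_mass_ext r = (if M < j then V r else (1 - r) * (M - j * r))"

lemma tail_mass_ext_eq: "r \<le> 1 \<Longrightarrow> tail_mass_ext r = V r"
  by (auto simp: tail_mass_ext_def tail_mass_def)

lemma tail_mass_ext_bound:
  assumes "0 \<le> \<epsilon>" "\<epsilon> \<le> 1" "0 \<le> r" "r \<le> 1 + \<epsilon>"
  shows "\<bar>tail_mass_ext r - V r\<bar> \<le> \<epsilon> * (M + 2 * j)"
proof (cases "r \<le> 1 \<or> M < j")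
  case True
  hence "tail_mass_ext r = V r" using tail_mass_ext_eq by (auto simp: tail_mass_ext_def)
  thus ?thesis using assms j M by simp
next
  case False
  have "\<bar>tail_mass_ext r - V r\<bar> = (r - 1) * \<bar>M - j * r\<bar>"
    using False by (simp add: tail_mass_ext_def tail_mass_ge_1 abs_mult)
  also have "\<dots> \<le> \<epsilon> * (M + 2 * j)"
  proof (intro mult_mono)
    have "j * r \<le> j * 2" "0 \<le> j * r" using j assms by (auto intro!: mult_left_mono)
    thus "\<bar>M - j * r\<bar> \<le> M + 2 * j" using M by linarith
  qed (use assms in auto)
  finally show ?thesis .
qed

text \<open>The square removes the kink at \<open>c\<close>: there the difference quotient is at
  most \<open>\<bar>h\<bar>\<close>.\<close>

lemma has_real_derivative_max_sq:
  "((\<lambda>r. (max 0 (c - r))\<^sup>2) has_real_derivative (- 2 * max 0 (c - r))) (at r)"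
proof (cases r c rule: linorder_cases)
  case less
  have "((\<lambda>r. (c - r)\<^sup>2) has_real_derivative (- 2 * (c - r))) (at r)"
    by (auto intro!: derivative_eq_intros)
  hence "((\<lambda>r. (max 0 (c - r))\<^sup>2) has_real_derivative (- 2 * (c - r))) (at r)"
    by (rule has_field_derivative_transform_within_open[where S = "{..<c}"]) (use less in auto)
  thus ?thesis using less by simp
next
  case greater
  have "((\<lambda>r. 0) has_real_derivative 0) (at r)" by simp
  hence "((\<lambda>r. (max 0 (c - r))\<^sup>2) has_real_derivative 0) (at r)"
    by (rule has_field_derivative_transform_within_open[where S = "{c<..}"]) (use greater in auto)
  thus ?thesis using greater by simp
next
  case equal
  have "((\<lambda>h. ((max 0 (c - (r + h)))\<^sup>2 - (max 0 (c - r))\<^sup>2) / h) \<longlongrightarrow> 0) (at 0)"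
  proof (rule Lim_null_comparison)
    show "\<forall>\<^sub>F h in at 0. norm (((max 0 (c - (r + h)))\<^sup>2 - (max 0 (c - r))\<^sup>2) / h) \<le> \<bar>h\<bar>"
      using equal by (intro always_eventually) (auto simp: power2_eq_square max_def)
    show "((\<lambda>h::real. \<bar>h\<bar>) \<longlongrightarrow> 0) (at 0)" by (auto intro!: tendsto_eq_intros)
  qed
  thus ?thesis using equal by (simp add: DERIV_def)
qed

text \<open>The branch \<open>M = 0\<close> merges with \<open>M < j\<close>, its edge being 0 and
  \<open>r \<ge> 0\<close>.\<close>

lemma rhoM_eq:
  assumes "0 \<le> r"
  shows "rhoM j M r = (if M < j then 2 * j * max 0 (sqrt (M / j) - r) else - 2 * j * r + (M + j))"
  using assms j by (auto simp: rhoM_def max_def)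

lemma has_integral_rhoM:
  assumes "0 \<le> r" "r \<le> s"
  shows "(rhoM j M has_integral (tail_mass_ext r - tail_mass_ext s)) {r..s}"
proof -
  have "((\<lambda>r. - tail_mass_ext r) has_vector_derivative rhoM j M x) (at x within {r..s})"
    if "x \<in> {r..s}" for x
  proof -
    have "((\<lambda>r. - tail_mass_ext r) has_real_derivative rhoM j M x) (at x)"
    proof (cases "M < j")
      case True
      have "((\<lambda>r. - (j * (max 0 (sqrt (M / j) - r))\<^sup>2)) has_real_derivative
          - (j * (- 2 * max 0 (sqrt (M / j) - x)))) (at x)"
        by (intro DERIV_minus DERIV_cmult has_real_derivative_max_sq)
      thus ?thesis using True rhoM_eq[of x] that assms by (simp add: tail_mass_ext_def tail_mass_def mult_ac)
    next
      case False
      have "((\<lambda>r. - ((1 - r) * (M - j * r))) has_real_derivative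
          - ((1 - x) * (- j) + (- 1) * (M - j * x))) (at x)"
        by (auto intro!: derivative_eq_intros)
      moreover have "- ((1 - x) * (- j) + (- 1) * (M - j * x)) = rhoM j M x"
        using False rhoM_eq[of x] that assms by (simp add: algebra_simps)
      ultimately show ?thesis using False by (simp only: tail_mass_ext_def if_False)
    qed
    thus ?thesis
      by (simp add: has_real_derivative_iff_has_vector_derivative has_vector_derivative_at_within)
  qed
  from fundamental_theorem_of_calculus[OF assms(2) this] show ?thesis by simp
qed

lemma integral_rhoM:
  assumes "0 \<le> r" "r \<le> 1"
  shows "integral {r..1} (rhoM j M) = V r"
  using has_integral_rhoM[OF assms] assms
  by (simp add: integral_unique tail_mass_ext_eq tail_mass_ge_1)

lemma continuous_on_rhoM: "continuous_on {0..} (rhoM j M)"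
proof -
  have "continuous_on {0..} (\<lambda>r. if M < j then 2 * j * max 0 (sqrt (M / j) - r) else - 2 * j * r + (M + j))"
    by (cases "M < j") (auto intro!: continuous_intros)
  thus ?thesis by (rule continuous_on_eq) (simp add: rhoM_eq)
qed

lemma rhoM_bounds:
  assumes "0 \<le> r" "r \<le> 1"
  shows "\<bar>rhoM j M r\<bar> \<le> M + 3 * j"
proof (cases "M < j")
  case True
  have "max 0 (sqrt (M / j) - r) \<le> 1" using edge_lt_1[OF True] assms by linarith
  hence "2 * j * max 0 (sqrt (M / j) - r) \<le> 2 * j * 1" using j by (intro mult_left_mono) auto
  moreover have "0 \<le> 2 * j * max 0 (sqrt (M / j) - r)" using j by simp
  ultimately show ?thesis unfolding rhoM_eq[OF assms(1)] if_P[OF True] using j M by linarith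
next
  case False
  have "j * r \<le> j * 1" "0 \<le> j * r" using j assms by (auto intro!: mult_left_mono)
  thus ?thesis using False assms by (simp add: rhoM_eq)
qed

lemma tail_mass_lipschitz:
  assumes "0 \<le> r" "r \<le> s" "s \<le> 1"
  shows "\<bar>V r - V s\<bar> \<le> (M + 3 * j) * (s - r)"
proof -
  have "norm (V r - V s) \<le> (M + 3 * j) * measure lborel (cbox r s)"
  proof (rule has_integral_bound)
    show "(rhoM j M has_integral (V r - V s)) (cbox r s)"
      using has_integral_rhoM[OF assms(1,2)] assms by (simp add: tail_mass_ext_eq)
    show "\<And>x. x \<in> cbox r s \<Longrightarrow> norm (rhoM j M x) \<le> M + 3 * j"
      using assms rhoM_bounds by auto
  qed (use j M in auto)
  thus ?thesis using assms by simp
qed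

section \<open>The profile on the lattice and the initial configurations\<close>

text \<open>Passing from mesh \<open>1 / N\<close> to \<open>1 / (N + 1)\<close> moves the argument
  by at most \<open>1 / N\<close>, which costs the Lipschitz constant \<open>M + 3 * j\<close>; the
  prefactor exceeds \<open>N\<close> by \<open>2 + 1 / N \<le> 3\<close>, and
  \<open>V \<le> M\<close>.\<close>

lemma lattice_profile_close:
  fixes x N :: nat
  assumes "1 \<le> N" "x \<le> N"
  shows "\<bar>(real N + 1)\<^sup>2 / N * V (x / (real N + 1)) - N * V (x / N)\<bar> \<le> 4 * M + 3 * j"
proof -
  have S: "(real N + 1)\<^sup>2 / N - N = 2 + 1 / N" using assms by (simp add: field_simps power2_eq_square)
  have "real x / N - x / (real N + 1) = x / N * (1 / (real N + 1))"
    using assms by (simp add: field_simps)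
  also have "\<dots> \<le> 1 * (1 / (real N + 1))" using assms by (intro mult_right_mono) auto
  also have "\<dots> \<le> 1 / N" using assms by (simp add: field_simps)
  finally have d: "real x / N - x / (real N + 1) \<le> 1 / N" .
  have "\<bar>V (x / (real N + 1)) - V (x / N)\<bar> \<le> (M + 3 * j) * (x / N - x / (real N + 1))"
    using assms by (intro tail_mass_lipschitz) (auto simp: field_simps)
  also have "\<dots> \<le> (M + 3 * j) * (1 / N)" using j M d by (intro mult_left_mono) auto
  finally have "N * \<bar>V (x / (real N + 1)) - V (x / N)\<bar> \<le> N * ((M + 3 * j) * (1 / N))"
    by (intro mult_left_mono) auto
  hence A: "\<bar>N * (V (x / (real N + 1)) - V (x / N))\<bar> \<le> M + 3 * j"
    using assms by (simp add: abs_mult)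
  have "V (x / (real N + 1)) \<le> V 0" by (rule tail_mass_antimono) auto
  hence "(2 + 1 / N) * V (x / (real N + 1)) \<le> 3 * M"
    using tail_mass_nonneg[of "x / (real N + 1)"] assms
    by (intro mult_mono) (auto simp: tail_mass_0)
  moreover have "0 \<le> (2 + 1 / N) * V (x / (real N + 1))"
    using tail_mass_nonneg by (intro mult_nonneg_nonneg) auto
  moreover have "(real N + 1)\<^sup>2 / N * V (x / (real N + 1)) - N * V (x / N)
      = N * (V (x / (real N + 1)) - V (x / N)) + (2 + 1 / N) * V (x / (real N + 1))"
    unfolding S[symmetric] by (simp add: algebra_simps)
  ultimately show ?thesis using A by linarith
qed

text \<open>For \<open>a \<ge> 1\<close> all three points lie on the parabola and the difference is
  2; for \<open>a \<le> 1\<close> the value \<open>p a\<close> is at most 1. This handles an edge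
  falling between lattice points.\<close>

lemma second_difference_max_sq:
  fixes a :: real
  defines "p \<equiv> \<lambda>a::real. (max 0 a)\<^sup>2"
  defines "d \<equiv> p (a + 1) + p (a - 1) - 2 * p a"
  shows "0 \<le> d" "d \<le> 2" "d = 2 \<or> p a \<le> 1"
proof -
  consider "1 \<le> a" | "0 \<le> a" "a \<le> 1" | "-1 \<le> a" "a \<le> 0" | "a \<le> -1" by linarith
  hence "0 \<le> d \<and> d \<le> 2 \<and> (d = 2 \<or> p a \<le> 1)"
  proof cases
    case 1
    thus ?thesis by (simp add: d_def p_def max_def power2_eq_square algebra_simps)
  next
    case 2
    have "0 \<le> (1 - a) * a" using 2 by simp
    moreover have "d = 2 - (1 - a) * (1 - a)" using 2 by (simp add: d_def p_def max_def power2_eq_square algebra_simps)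
    moreover have "(1 - a) * (1 - a) \<le> 1" using 2 by (intro mult_le_one) auto
    moreover have "p a \<le> 1" using 2 by (simp add: p_def power_le_one)
    ultimately show ?thesis by (smt (verit) zero_le_square)
  next
    case 3
    have "d = (1 + a)\<^sup>2" using 3 by (simp add: d_def p_def max_def algebra_simps)
    moreover have "(1 + a)\<^sup>2 \<le> 1" using 3 by (intro power_le_one) auto
    moreover have "p a = 0" using 3 by (simp add: p_def)
    ultimately show ?thesis by auto
  next
    case 4
    hence "max 0 (a + 1) = 0" "max 0 a = 0" "max 0 (a - 1) = 0" by auto
    thus ?thesis by (simp add: d_def p_def)
  qed
  thus "0 \<le> d" "d \<le> 2" "d = 2 \<or> p a \<le> 1" by auto
qed

text \<open>Mesh \<open>1 / (N + 1)\<close> puts the zero boundary value at the site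
  \<open>N + 1\<close>, and the prefactor makes second differences exactly \<open>2 * j / N\<close>
  wherever the profile is quadratic.\<close>

definition lattice_profile :: "nat \<Rightarrow> nat \<Rightarrow> real" where
  "lattice_profile N x = (real N + 1)\<^sup>2 / N * V (x / (real N + 1))"

text \<open>\<open>\<theta>\<close> is defined by the equation it has to satisfy, so its bounds are
  the content. For \<open>M < j\<close> they come from \<open>second_difference_max_sq\<close> at
  \<open>R - x\<close>, with \<open>R\<close> the edge in lattice units; for
  \<open>M \<ge> j\<close> the profile is quadratic on all sites up to \<open>N + 1\<close> and
  \<open>\<theta> = 1\<close>.\<close>

lemma profile_lattice_profile:
  assumes N: "1 \<le> N"
  shows "profile j N (lattice_profile N)
    (\<lambda>x. N / (2 * j) * (lattice_profile N (x - 1) + lattice_profile N (x + 1) - 2 * lattice_profile N x))"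
    (is "profile j N ?G ?\<theta>")
proof -
  have props: "0 \<le> ?\<theta> x \<and> ?\<theta> x \<le> 1 \<and> (?\<theta> x = 1 \<or> ?G x \<le> j / N)" if x: "x \<in> {1..N}" for x
  proof (cases "M < j")
    case True
    define R where "R = (real N + 1) * sqrt (M / j)"
    have G: "?G y = j / N * (max 0 (R - y))\<^sup>2" for y
    proof -
      have "(real N + 1) * max 0 (sqrt (M / j) - y / (real N + 1)) = max 0 (R - y)"
        by (simp add: R_def max_mult_distrib_left right_diff_distrib)
      hence "(real N + 1)\<^sup>2 * (max 0 (sqrt (M / j) - y / (real N + 1)))\<^sup>2 = (max 0 (R - y))\<^sup>2"
        by (metis power_mult_distrib)
      from arg_cong[OF this, of "\<lambda>z. j / N * z"] show ?thesis
        using True by (simp add: lattice_profile_def tail_mass_def mult_ac)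
    qed
    define d where "d = (max 0 (R - x + 1))\<^sup>2 + (max 0 (R - x - 1))\<^sup>2 - 2 * (max 0 (R - x))\<^sup>2"
    have eqs: "R - real (x - 1) = R - x + 1" "R - real (x + 1) = R - x - 1" using x by (auto simp: of_nat_diff)
    have "j / N * A + j / N * B - 2 * (j / N * C) = j / N * (A + B - 2 * C)" for A B C :: real
      by (simp add: algebra_simps add_divide_distrib)
    hence "?G (x - 1) + ?G (x + 1) - 2 * ?G x = j / N * d" unfolding G eqs d_def by blast
    hence \<theta>: "?\<theta> x = d / 2" using j N by simp
    have d: "0 \<le> d" "d \<le> 2" "d = 2 \<or> (max 0 (R - x))\<^sup>2 \<le> 1"
      using second_difference_max_sq[of "R - x"] by (auto simp: d_def)
    have "?G x \<le> j / N" if "(max 0 (R - x))\<^sup>2 \<le> 1"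
      unfolding G using that j by (intro mult_left_le) auto
    thus ?thesis using d unfolding \<theta> by auto
  next
    case False
    define K where "K = real N + 1"
    have K: "K > 0" by (simp add: K_def)
    have G: "?G y = ((K - y) * (M * K - j * y)) / N" if "y \<le> N + 1" for y
    proof -
      have "y / K \<le> 1" using that K by (simp add: K_def)
      hence "K * max 0 (1 - y / K) = K - y" "K * (M - j * (y / K)) = M * K - j * y"
        using K by (simp_all add: right_diff_distrib)
      moreover have "?G y = (K * max 0 (1 - y / K)) * (K * (M - j * (y / K))) / N"
        using False by (simp add: lattice_profile_def tail_mass_def K_def power2_eq_square)
      ultimately show ?thesis by simp
    qed
    have le: "x - 1 \<le> N + 1" "x + 1 \<le> N + 1" "x \<le> N + 1" using x by auto
    have eqs: "real (x - 1) = real x - 1" "real (x + 1) = real x + 1" using x by (auto simp: of_nat_diff)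
    have "((K - (y - 1)) * (P - j * (y - 1))) / N + ((K - (y + 1)) * (P - j * (y + 1))) / N
        - 2 * (((K - y) * (P - j * y)) / N) = 2 * j / N" for y P :: real
      by (simp add: add_divide_distrib[symmetric] diff_divide_distrib[symmetric] algebra_simps)
    hence "?G (x - 1) + ?G (x + 1) - 2 * ?G x = 2 * j / N" unfolding le[THEN G] eqs by blast
    hence \<theta>: "?\<theta> x = 1" using j N by simp
    show ?thesis unfolding \<theta> by simp
  qed
  show ?thesis
  proof
    show "?G (N + 1) = 0" using N by (simp add: lattice_profile_def tail_mass_ge_1 add.commute)
    show "0 \<le> ?G x \<and> ?G x \<le> ?G 0" for x
      using tail_mass_nonneg[of "x / (real N + 1)"] tail_mass_antimono[of 0 "x / (real N + 1)"]
      by (auto simp: lattice_profile_def intro!: mult_left_mono divide_right_mono)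
    show "?G (x - 1) + ?G (x + 1) - 2 * ?G x = 2 * j / N * ?\<theta> x" for x
      using j N by simp
  qed (use j N props in auto)
qed

lemma lattice_profile_0_le:
  assumes "1 \<le> N"
  shows "lattice_profile N 0 \<le> 4 * M * N"
proof -
  have "(real N + 1)\<^sup>2 \<le> (2 * real N)\<^sup>2" using assms by (intro power_mono) auto
  hence "(real N + 1)\<^sup>2 / N \<le> 4 * N" using assms by (simp add: field_simps power2_eq_square)
  from mult_right_mono[OF this M] show ?thesis by (simp add: lattice_profile_def tail_mass_0 mult_ac)
qed

text \<open>Rounding up keeps the tail sums positive exactly where the tail mass is, so the rightmost
  particle sits at the edge up to one site.\<close>

definition init_config :: "nat \<Rightarrow> nat \<Rightarrow> nat" where
  "init_config N x = (if x < N then nat (\<lceil>N * V (x / N)\<rceil> - \<lceil>N * V (Suc x / N)\<rceil>) else 0)"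

text \<open>The sum telescopes from the right end, where the tail mass vanishes; as the tail mass is
  antimonotone, \<open>nat\<close> cuts off nothing.\<close>

lemma tailsum_init_config:
  assumes "x \<le> N + 1"
  shows "tailsum N (init_config N) x = \<lceil>N * V (x / N)\<rceil>"
proof (cases "x \<le> N")
  case True
  thus ?thesis
  proof (induction rule: inc_induct)
    case base
    show ?case by (cases "N = 0") (auto simp: tailsum_def init_config_def tail_mass_ge_1)
  next
    case (step x)
    have "N * V (Suc x / N) \<le> N * V (x / N)"
      by (intro mult_left_mono tail_mass_antimono divide_right_mono) auto
    hence "\<lceil>N * V (Suc x / N)\<rceil> \<le> \<lceil>N * V (x / N)\<rceil>" by (rule ceiling_mono)
    thus ?case using step by (simp add: tailsum_rec init_config_def)
  qed
next
  case False
  hence "x = N + 1" using assms by simp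
  thus ?thesis by (cases "N = 0") (auto simp: tailsum_outside tail_mass_ge_1)
qed

lemma tailsum_init_config_close:
  assumes "x \<le> N"
  shows "\<bar>tailsum N (init_config N) x - N * V (x / N)\<bar> \<le> 1"
  using assms by (simp add: tailsum_init_config) linarith

text \<open>The block sum and \<open>N\<close> times the integral are both differences of tail
  masses at the ends of the block. They differ by at most 1 through rounding and
  \<open>2 * (M + 2 * j)\<close> through the cut-off beyond 1.\<close>

lemma init_config_block:
  assumes "1 \<le> N" "1 \<le> l" "x + l \<le> N + 1"
  shows "\<bar>blockavg l x (init_config N) - blockint N l x (rhoM j M)\<bar> \<le> (1 + 2 * (M + 2 * j)) / l"
proof -
  define A where "A = N * V (x / N)"
  define B where "B = N * V ((x + l) / N)"
  define I where "I = integral {real x / N..real (x + l) / N} (rhoM j M)"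
  have "tailsum N (init_config N) x = (\<Sum>y\<in>{x..<x+l}. real (init_config N y)) + tailsum N (init_config N) (x + l)"
  proof -
    have "{x..N} = {x..<x+l} \<union> {x+l..N}" using assms by auto
    thus ?thesis unfolding tailsum_def by (simp add: sum.union_disjoint ivl_disj_int)
  qed
  hence sum: "(\<Sum>y\<in>{x..<x+l}. real (init_config N y)) = \<lceil>A\<rceil> - \<lceil>B\<rceil>"
    using assms by (simp add: tailsum_init_config A_def B_def)
  have bd: "0 \<le> real x / N" "real x / N \<le> 1 + 1 / N" "0 \<le> real (x + l) / N"
     "real (x + l) / N \<le> 1 + 1 / N" "real x / N \<le> real (x + l) / N" "1 / real N \<le> 1"
  proof -
    have "1 + 1 / real N = (real N + 1) / N" using assms by (simp add: field_simps)
    moreover have "real x \<le> real N + 1" "real (x + l) \<le> real N + 1" using assms by linarith+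
    ultimately show "real x / N \<le> 1 + 1 / N" "real (x + l) / N \<le> 1 + 1 / N"
      by (simp_all only: divide_right_mono of_nat_0_le_iff)
  qed (use assms in \<open>auto simp: divide_right_mono\<close>)
  have "\<bar>tail_mass_ext (x / N) - V (x / N)\<bar> \<le> 1 / N * (M + 2 * j)"
    "\<bar>tail_mass_ext ((x + l) / N) - V ((x + l) / N)\<bar> \<le> 1 / N * (M + 2 * j)"
    using bd by (intro tail_mass_ext_bound; simp)+
  moreover have "I = tail_mass_ext (x / N) - tail_mass_ext ((x + l) / N)"
    unfolding I_def using bd by (intro integral_unique has_integral_rhoM) auto
  ultimately have "\<bar>I - (V (x / N) - V ((x + l) / N))\<bar> \<le> 1 / N * (M + 2 * j) + 1 / N * (M + 2 * j)"
    by linarith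
  also have "\<dots> = 2 * (M + 2 * j) / N" by simp
  finally have "\<bar>I - (V (x / N) - V ((x + l) / N))\<bar> \<le> 2 * (M + 2 * j) / N" .
  hence "N * \<bar>I - (V (x / N) - V ((x + l) / N))\<bar> \<le> N * (2 * (M + 2 * j) / N)"
    by (intro mult_left_mono) auto
  hence "\<bar>N * I - (A - B)\<bar> \<le> 2 * (M + 2 * j)"
    using assms unfolding A_def B_def right_diff_distrib[symmetric] by (simp add: abs_mult)
  moreover have "\<bar>(real_of_int \<lceil>A\<rceil> - \<lceil>B\<rceil>) - (A - B)\<bar> \<le> 1" by linarith
  ultimately have "\<bar>(real_of_int \<lceil>A\<rceil> - \<lceil>B\<rceil>) - N * I\<bar> \<le> 1 + 2 * (M + 2 * j)" by linarith
  moreover have "blockavg l x (init_config N) - blockint N l x (rhoM j M) = ((real_of_int \<lceil>A\<rceil> - \<lceil>B\<rceil>) - N * I) / l"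
    by (simp add: blockavg_def blockint_def sum I_def diff_divide_distrib)
  ultimately show ?thesis by (simp add: divide_right_mono)
qed

text \<open>At \<open>M = j\<close> the edge is exactly 1 and the two branches agree.\<close>

lemma tail_mass_edge: "M \<le> j \<Longrightarrow> V r = j * (max 0 (sqrt (M / j) - r))\<^sup>2"
  using j by (cases "M = j") (auto simp: tail_mass_def max_def power2_eq_square algebra_simps)

lemma edge_rhoM:
  assumes "has_edge (rhoM j M)"
  shows "M \<le> j" "edge (rhoM j M) = sqrt (M / j)"
proof -
  show Mj: "M \<le> j"
  proof (rule ccontr)
    assume "\<not> M \<le> j"
    hence "rhoM j M 1 \<noteq> 0" by (simp add: rhoM_eq)
    thus False using assms by (auto simp: has_edge_def)
  qed
  define R where "R = sqrt (M / j)"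
  have R: "0 \<le> R" "R \<le> 1" using j M Mj by (auto simp: R_def)
  have zero: "rhoM j M r = 0 \<longleftrightarrow> R \<le> r" if "0 \<le> r" "r \<le> 1" for r
  proof -
    have "rhoM j M r = 2 * j * max 0 (R - r)"
      using rhoM_eq[OF that(1)] that j Mj by (cases "M = j") (auto simp: R_def algebra_simps max_def)
    thus ?thesis using j by (auto simp: max_def)
  qed
  have "{r\<in>{0..1}. \<forall>r'\<in>{r..1}. rhoM j M r' = 0} = {R..1}" (is "?A = _")
  proof (intro set_eqI iffI)
    fix r assume "r \<in> ?A"
    thus "r \<in> {R..1}" using zero[of r] by auto
  next
    fix r assume r: "r \<in> {R..1}"
    have "rhoM j M r' = 0" if "r' \<in> {r..1}" for r'
      using r R that by (subst zero) auto
    thus "r \<in> ?A" using r R by auto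
  qed
  thus "edge (rhoM j M) = sqrt (M / j)" using R by (simp add: edge_def R_def)
qed

lemma init_config_rightmost:
  assumes "1 \<le> N" "M \<le> j"
  shows "\<bar>rightmost N (init_config N) / N - sqrt (M / j)\<bar> \<le> 1 / N"
proof -
  define R where "R = sqrt (M / j)"
  have R: "0 \<le> R" "R = 0 \<longleftrightarrow> M = 0" using j M by (auto simp: R_def)
  have pos: "0 < tailsum N (init_config N) x \<longleftrightarrow> x < R * N" if "x \<le> N" for x
  proof -
    have "0 < tailsum N (init_config N) x \<longleftrightarrow> 0 < real N * V (x / N)"
      using that by (simp add: tailsum_init_config zero_less_ceiling)
    also have "\<dots> \<longleftrightarrow> real x / N < R"
      using assms j by (auto simp: tail_mass_edge R_def max_def zero_less_mult_iff)
    finally show ?thesis using assms by (simp add: field_simps)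
  qed
  have R1: "R \<le> 1" using assms j M by (simp add: R_def)
  have "\<bar>rightmost N (init_config N) - R * N\<bar> \<le> 1"
  proof (cases "\<exists>y\<le>N. 0 < init_config N y")
    case False
    hence "rightmost N (init_config N) = 0" unfolding rightmost_def by (rule if_not_P)
    moreover have "tailsum N (init_config N) 0 = 0" using False by (auto simp: tailsum_def)
    hence "\<not> 0 < R * N" using pos[of 0] by simp
    ultimately show ?thesis using R by (smt (verit) mult_nonneg_nonneg of_nat_0 of_nat_0_le_iff)
  next
    case True
    note rm = rightmost_props(1)[OF True]
    have "rightmost N (init_config N) < R * N"
      using pos[OF rm] tailsum_pos_iff[OF True] by blast
    moreover have "R * N \<le> rightmost N (init_config N) + 1"
    proof (rule ccontr)
      assume *: "\<not> ?thesis"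
      moreover have "R * N \<le> N" using R1 by (simp add: mult_left_le_one_le R)
      ultimately have "rightmost N (init_config N) + 1 \<le> N" by linarith
      from pos[OF this] * show False using tailsum_pos_iff[OF True, of "rightmost N (init_config N) + 1"] by simp
    qed
    ultimately show ?thesis by linarith
  qed
  hence "\<bar>rightmost N (init_config N) - R * N\<bar> / N \<le> 1 / N" by (rule divide_right_mono) simp
  moreover have "\<bar>rightmost N (init_config N) - R * N\<bar> / N = \<bar>rightmost N (init_config N) / N - R\<bar>"
  proof -
    have "rightmost N (init_config N) / N - R = (rightmost N (init_config N) - R * N) / N"
      using assms by (simp add: diff_divide_distrib)
    thus ?thesis by simp
  qed
  ultimately show ?thesis by (simp add: R_def)
qed

text \<open>The block error is of order \<open>N powr (- b)\<close> and the edge error at most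
  \<open>1 / N\<close>; by \<open>a < b\<close> and \<open>a < 1\<close> both are eventually below
  \<open>N powr (- a)\<close>.\<close>

lemma approximates_init_config:
  assumes "0 < a" "a < 1" "a < b"
  shows "approximates a b (rhoM j M) init_config"
  unfolding approximates_def
proof (intro conjI allI)
  show "is_config N (init_config N)" for N by (simp add: is_config_def init_config_def)
  define C where "C = 1 + 2 * (M + 2 * j)"
  have C: "C > 0" using j M by (simp add: C_def)
  have "\<forall>\<^sub>F N in sequentially. C < (real N powr b - 1) * (1 / real N) powr a"
    using assms by real_asymp
  moreover have "\<forall>\<^sub>F N in sequentially. 2 \<le> real N powr b"
    using assms by real_asymp
  moreover have "\<forall>\<^sub>F N in sequentially. 1 \<le> (N::nat)" by (rule eventually_ge_at_top)
  ultimately show "\<forall>\<^sub>F N in sequentially. (let l = nat \<lfloor>real N powr b\<rfloor> in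
        (\<forall>x. x + l \<le> N + 1 \<longrightarrow> \<bar>blockavg l x (init_config N) - blockint N l x (rhoM j M)\<bar> \<le> (1 / real N) powr a))
        \<and> (has_edge (rhoM j M) \<longrightarrow>
             \<bar>real (rightmost N (init_config N)) / real N - edge (rhoM j M)\<bar> \<le> (1 / real N) powr a)"
  proof eventually_elim
    case (elim N)
    define l where "l = nat \<lfloor>real N powr b\<rfloor>"
    have l: "real N powr b - 1 \<le> l" "1 \<le> l" using elim(2) unfolding l_def by linarith+
    have "C \<le> l * (1 / real N) powr a"
      using elim(1) mult_right_mono[OF l(1), of "(1 / real N) powr a"] by simp
    hence "C / l \<le> (1 / real N) powr a" using l by (simp add: field_simps)
    hence 1: "\<bar>blockavg l x (init_config N) - blockint N l x (rhoM j M)\<bar> \<le> (1 / real N) powr a"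
      if "x + l \<le> N + 1" for x
      using init_config_block[OF elim(3) l(2) that] unfolding C_def by linarith
    have "1 / real N = (1 / real N) powr 1" by simp
    also have "\<dots> \<le> (1 / real N) powr a" using assms elim(3) by (intro powr_mono') auto
    finally have "1 / real N \<le> (1 / real N) powr a" .
    with 1 show ?case unfolding Let_def l_def[symmetric]
      using init_config_rightmost[OF elim(3)] edge_rhoM by fastforce
  qed
qed

end

subsection \<open>Identification of the limit\<close>

context mass
begin

text \<open>The order of choices matters: the gap fixes \<open>w\<close>, \<open>\<delta>\<close>
  and so \<open>\<kappa>\<close>; then \<open>n\<close> makes the limiting Markov bound smaller than
  1; only then \<open>N\<close> tends to infinity, which removes all terms of \<open>H N\<close>
  below order \<open>N^3\<close>.\<close>

lemma limit_tail_eq: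
  assumes t: "0 \<le> t" and v: "continuous_on {0..1} v" and r: "0 < r" "r < 1"
    and lim: "\<And>\<zeta>. 0 < \<zeta> \<Longrightarrow> (\<lambda>N. prob_at j N (init_config N) (real N ^ 2 * t)
        (\<lambda>\<eta>. \<forall>x\<le>N. \<bar>tailsum N \<eta> x / N - v (x / N)\<bar> \<le> \<zeta>)) \<longlonglongrightarrow> 1"
  shows "v r = V r"
proof (rule ccontr)
  assume neq: "v r \<noteq> V r"
  define s where "s = sgn (v r - V r)"
  \<comment> \<open>The gap \<open>4 * w\<close> is spent as follows: \<open>w\<close> on continuity
    over the window, \<open>w / 2\<close> on the event of the hydrodynamic limit and
    \<open>w / 2\<close> on replacing \<open>V\<close> by the lattice profile. The remaining
    \<open>2 * w\<close> is what \<open>lyapunov_window_ge\<close> asks for.\<close>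
  define w where "w = \<bar>v r - V r\<bar> / 4"
  have s: "\<bar>s\<bar> = 1" and w: "0 < w" and sw: "s * (v r - V r) = 4 * w"
    using neq by (auto simp: s_def w_def sgn_if)
  have "continuous_on {0..1} V"
  proof -
    have "(M + 3 * j)-lipschitz_on {0..1} V"
    proof (rule lipschitz_onI)
      show "dist (V x) (V y) \<le> (M + 3 * j) * dist x y" if "x \<in> {0..1}" "y \<in> {0..1}" for x y
        using that tail_mass_lipschitz[of x y] tail_mass_lipschitz[of y x]
        by (cases "x \<le> y") (auto simp: dist_real_def abs_minus_commute)
    qed (use j M in auto)
    thus ?thesis by (rule lipschitz_on_continuous_on)
  qed
  hence "continuous_on {0..1} (\<lambda>x. s * (v x - V x))" by (intro continuous_intros v)
  moreover have "r \<in> {0..1}" using r by simp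
  ultimately obtain d where d: "d > 0"
    "\<And>x. x \<in> {0..1} \<Longrightarrow> dist x r < d \<Longrightarrow> dist (s * (v x - V x)) (s * (v r - V r)) < w"
    unfolding continuous_on_iff using w by blast
  define \<delta> where "\<delta> = min (d / 2) (min (r / 2) ((1 - r) / 2))"
  have \<delta>: "0 < \<delta>" "\<delta> \<le> 1" "0 < r - \<delta>" "r + \<delta> < 1" "\<delta> < d"
  proof -
    have "0 < \<delta>" using d(1) r by (simp add: \<delta>_def)
    moreover have "\<delta> \<le> d / 2" unfolding \<delta>_def by (rule min.cobounded1)
    moreover have "\<delta> \<le> r / 2" unfolding \<delta>_def by (rule order_trans[OF min.cobounded2 min.cobounded1])
    moreover have "\<delta> \<le> (1 - r) / 2" unfolding \<delta>_def by (rule order_trans[OF min.cobounded2 min.cobounded2])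
    hence "2 * \<delta> \<le> 1 - r" by simp
    ultimately show "0 < \<delta>" "\<delta> \<le> 1" "0 < r - \<delta>" "r + \<delta> < 1" "\<delta> < d" using d(1) r by linarith+
  qed
  have diff: "3 * w \<le> s * (v x - V x)" if "\<bar>x - r\<bar> \<le> \<delta>" for x
  proof -
    have "dist (s * (v x - V x)) (s * (v r - V r)) < w"
      using that \<delta> by (intro d(2)) (auto simp: dist_real_def)
    thus ?thesis unfolding sw dist_real_def by linarith
  qed
  define \<kappa> where "\<kappa> = \<delta> * w\<^sup>2"
  have \<kappa>: "0 < \<kappa>" using \<delta> w by (simp add: \<kappa>_def)
  \<comment> \<open>Only even \<open>n = 2 * m\<close> are considered, as
    \<open>delta_bound_tendsto\<close> gives the decay along these.\<close>
  have "(\<lambda>m. exp t * (4 * M * delta_bound (2 * m)) / \<kappa>) \<longlonglongrightarrow> exp t * (4 * M * 0) / \<kappa>"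
    by (intro tendsto_intros delta_bound_tendsto) (use \<kappa> in auto)
  hence "\<forall>\<^sub>F m in sequentially. exp t * (4 * M * delta_bound (2 * m)) / \<kappa> < 1"
    by (intro order_tendstoD(2)) auto
  then obtain m where m: "exp t * (4 * M * delta_bound (2 * m)) / \<kappa> < 1"
    unfolding eventually_sequentially by blast
  define n where "n = 2 * m"
  define c where "c = delta_bound n"
  \<comment> \<open>One unit for rounding the initial configuration, the rest for the distance of
    the lattice profile from \<open>N * V (x / N)\<close>.\<close>
  define B where "B = 1 + (4 * M + 3 * j)"
  define C where "C = 2 * j + 4 * j * real n + 1"
  define C0 where "C0 = 2 * j\<^sup>2 * (1 + 2 * real n) + 2 * j + 16 * j * real n * M"
  define H where "H N = (real N * (2 * B)\<^sup>2 + C * (real N * sqrt N) * B\<^sup>2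
     + (real N)\<^sup>2 * (C0 + 4 * M * c * N + C * (1 + 2 * j) * sqrt N))" for N
  define E where "E N = (\<lambda>\<eta>. \<forall>x\<le>N. \<bar>tailsum N \<eta> x / N - v (x / N)\<bar> \<le> w / 2)" for N
  have "\<forall>\<^sub>F N in sequentially. prob_at j N (init_config N) (real N ^ 2 * t) (E N)
     \<le> exp t * H N / (\<kappa> * real N ^ 3)"
  proof -
    have "\<forall>\<^sub>F N in sequentially. (1::nat) \<le> N" by (rule eventually_ge_at_top)
    moreover have "\<forall>\<^sub>F N in sequentially. 2 * real n + 1 \<le> \<delta> * real N" using \<delta> by real_asymp
    moreover have "\<forall>\<^sub>F N in sequentially. 4 * M + 3 * j \<le> w / 2 * real N" using w by real_asymp
    ultimately show ?thesis
    proof eventually_elim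
      case (elim N)
      define G where "G = lattice_profile N"
      obtain \<theta> where "profile j N G \<theta>" using profile_lattice_profile[OF elim(1)] by (auto simp: G_def)
      then interpret p: profile j N G \<theta> .
      have G_close: "\<bar>G x - N * V (x / N)\<bar> \<le> 4 * M + 3 * j" if "x \<le> N" for x
        using lattice_profile_close[OF elim(1) that] by (simp add: G_def lattice_profile_def)
      have init: "p.lyapunov M n (init_config N) \<le> H N"
        unfolding H_def C_def C0_def c_def
      proof (rule p.lyapunov_close)
        show "\<bar>p.D (init_config N) x\<bar> \<le> B" if "x \<le> N" for x
          using tailsum_init_config_close[OF that] G_close[OF that] unfolding deviation_def B_def by linarith
      qed
      \<comment> \<open>Growth rate \<open>1 / N^2\<close> over the time \<open>N^2 * t\<close>
        gives the factor \<open>exp t\<close>, independent of \<open>N\<close>.\<close>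
      have "prob_at j N (init_config N) (real N ^ 2 * t) (E N)
         \<le> exp (1 / (real N)\<^sup>2 * (real N ^ 2 * t)) * p.lyapunov M n (init_config N) / (\<kappa> * real N ^ 3)"
      proof (rule prob_at_markov)
        show "0 \<le> p.lyapunov M n \<xi>" for \<xi>
          using p.lyapunov_ge(1)[OF M] energy_nonneg by (rule order_trans[rotated])
        show "sum_list (map (\<lambda>(r, \<zeta>). r * p.lyapunov M n \<zeta>) (transitions j N \<xi>))
           \<le> (1 / (real N)\<^sup>2 + exit_rate j N \<xi>) * p.lyapunov M n \<xi>" for \<xi>
          unfolding gen_le_iff using lattice_profile_0_le[OF elim(1)] M
          by (intro p.gen_lyapunov_le) (auto simp: G_def)
        show "is_config N (init_config N)" by (simp add: is_config_def init_config_def)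
        show "\<kappa> * real N ^ 3 \<le> p.lyapunov M n \<eta>" if "E N \<eta>" for \<eta>
          unfolding \<kappa>_def
        proof (rule p.lyapunov_window_ge[OF M s _ _ \<delta>(2-4) elim(2)])
          fix x :: nat assume x: "\<bar>real x - r * N\<bar> \<le> \<delta> * N"
          have "real x - r * N = N * (x / N - r)" using elim(1) by (simp add: field_simps)
          hence xr: "\<bar>x / N - r\<bar> \<le> \<delta>" using x elim(1) by (simp add: abs_mult mult.commute)
          hence "x / N \<le> 1" using \<delta> by linarith
          hence xN: "x \<le> N" using elim(1) by simp
          have near: "\<bar>s * (tailsum N \<eta> x / N - v (x / N))\<bar> \<le> w / 2"
            using that xN s by (auto simp: E_def abs_mult)
          have "5 / 2 * w \<le> s * (tailsum N \<eta> x / N - v (x / N)) + s * (v (x / N) - V (x / N))"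
          proof -
            have "5 / 2 * w \<le> p + q" if "\<bar>p\<bar> \<le> w / 2" "3 * w \<le> q" for p q :: real
              using that by linarith
            from this[OF near diff[OF xr]] show ?thesis .
          qed
          hence "5 / 2 * w \<le> s * (tailsum N \<eta> x / N - V (x / N))" by (simp add: right_diff_distrib)
          hence "N * (5 / 2 * w) \<le> N * (s * (tailsum N \<eta> x / N - V (x / N)))" by (intro mult_left_mono) auto
          hence "5 / 2 * (w * N) \<le> s * tailsum N \<eta> x - s * (N * V (x / N))"
            using elim(1) by (simp add: algebra_simps)
          moreover have "\<bar>s * (G x - N * V (x / N))\<bar> \<le> (w * N) / 2"
            using G_close[OF xN] elim(3) s by (simp add: abs_mult)
          hence "\<bar>s * G x - s * (N * V (x / N))\<bar> \<le> (w * N) / 2" by (simp add: right_diff_distrib)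
          moreover have "2 * q \<le> p - u" if "5 / 2 * q \<le> p - p'" "\<bar>u - p'\<bar> \<le> q / 2" for p p' q u :: real
            using that by linarith
          ultimately have "2 * (w * N) \<le> s * tailsum N \<eta> x - s * G x" by blast
          thus "2 * w * N \<le> s * p.D \<eta> x" by (simp add: deviation_def right_diff_distrib)
        qed (use w \<delta> in auto)
      qed (use j t elim(1) \<kappa> in auto)
      also have "\<dots> \<le> exp t * H N / (\<kappa> * real N ^ 3)"
        using init elim(1) \<kappa> by (intro divide_right_mono mult_mono) (auto intro: order_trans[OF energy_nonneg p.lyapunov_ge(1)[OF M]])
      finally show ?case .
    qed
  qed
  moreover have "(\<lambda>N. exp t * H N / (\<kappa> * real N ^ 3)) \<longlonglongrightarrow> exp t * (4 * M * c) / \<kappa>"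
  proof -
    \<comment> \<open>Of \<open>H N\<close> only the noise term survives the division by
      \<open>N^3\<close>.\<close>
    have "(\<lambda>N. H N / real N ^ 3) \<longlonglongrightarrow> 4 * M * c" unfolding H_def by real_asymp
    hence "(\<lambda>N. exp t * (H N / real N ^ 3) / \<kappa>) \<longlonglongrightarrow> exp t * (4 * M * c) / \<kappa>"
      by (intro tendsto_intros) (use \<kappa> in auto)
    thus ?thesis by (simp add: mult_ac)
  qed
  moreover have "(\<lambda>N. prob_at j N (init_config N) (real N ^ 2 * t) (E N)) \<longlonglongrightarrow> 1"
    unfolding E_def using w by (intro lim) auto
  ultimately have "1 \<le> exp t * (4 * M * c) / \<kappa>"
    by (intro tendsto_le[OF sequentially_bot])
  thus False using m by (simp add: c_def n_def)
qed

end

text \<open>On the open interval the integrals from 0 are constant because the tail integrals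
  vanish, so their derivative \<open>f\<close> is 0; continuity covers the end points.\<close>

lemma continuous_zero_from_tail_integrals:
  fixes f :: "real \<Rightarrow> real"
  assumes "continuous_on {0..1} f" and zero: "\<And>r. 0 < r \<Longrightarrow> r < 1 \<Longrightarrow> integral {r..1} f = 0"
    and x: "x \<in> {0..1}"
  shows "f x = 0"
proof (rule continuous_constant_on_closure[of "{0<..<1}" f 0])
  show "continuous_on (closure {0<..<1}) f" "x \<in> closure {0<..<1::real}" using assms by auto
  fix y :: real assume y: "y \<in> {0<..<1}"
  have int: "f integrable_on {0..1}" by (intro integrable_continuous_interval assms)
  have "((\<lambda>u. integral {0..u} f) has_real_derivative f y) (at y within {0..1})"
    using y assms by (intro integral_has_real_derivative) auto
  hence "((\<lambda>u. integral {0..u} f) has_real_derivative f y) (at y within {0<..<1})"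
    by (rule has_field_derivative_subset) auto
  hence D: "((\<lambda>u. integral {0..u} f) has_real_derivative f y) (at y)"
    using y by (simp add: at_within_open[of y "{0<..<1}"])
  have "((\<lambda>u. integral {0..1} f) has_real_derivative 0) (at y)" by simp
  hence "((\<lambda>u. integral {0..u} f) has_real_derivative 0) (at y)"
  proof (rule has_field_derivative_transform_within_open[where S = "{0<..<1}"])
    fix u :: real assume u: "u \<in> {0<..<1}"
    have "integral {0..u} f + integral {u..1} f = integral {0..1} f"
      using u int by (intro Henstock_Kurzweil_Integration.integral_combine) auto
    thus "integral {0..1} f = integral {0..u} f" using zero u by simp
  qed (use y in auto)
  with D show "f y = 0" by (rule DERIV_unique)
qed

theorem theorem2p7:
  fixes j M a b :: real and \<rho> :: "real \<Rightarrow> real \<Rightarrow> real"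
  assumes "0 < j" and "0 \<le> M"
    and "0 < a" and "0 < b" and "b < 1" and "a < b" and "a < 1 - b"
    and "hydro_limit j a b (rhoM j M) \<rho>"
  shows "\<forall>t\<ge>0. \<forall>r\<in>{0..1}. \<rho> t r = rhoM j M r"
proof (intro allI impI ballI)
  fix t r :: real assume t: "0 \<le> t" and r: "r \<in> {0..1}"
  interpret mass j M using assms by unfold_locales
  have "continuous_on ({0..} \<times> {0..1}) (\<lambda>(t, r). \<rho> t r)"
    using assms(8) by (simp add: hydro_limit_def)
  hence "continuous_on {0..1} (\<lambda>r. (\<lambda>(t, r). \<rho> t r) (t, r))"
    using t by (intro continuous_on_compose2[of "{0..} \<times> {0..1}" "\<lambda>(t, r). \<rho> t r" "{0..1}" "Pair t"] continuous_intros) auto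
  hence cont: "continuous_on {0..1} (\<rho> t)" by simp
  have cont': "continuous_on {0..1} (rhoM j M)" by (rule continuous_on_subset[OF continuous_on_rhoM]) auto
  \<comment> \<open>The limit is assumed along every approximating family, so it can be tested on
    \<open>init_config\<close>; \<open>a < 1\<close> follows from \<open>a < 1 - b\<close> and
    \<open>0 < b\<close>.\<close>
  have "approximates a b (rhoM j M) init_config"
    using assms by (intro approximates_init_config) auto
  hence lim: "(\<lambda>N. prob_at j N (init_config N) (real N ^ 2 * t)
        (\<lambda>\<eta>. \<forall>x\<le>N. \<bar>tailsum N \<eta> x / N - integral {real x / N..1} (\<rho> t)\<bar> \<le> \<zeta>)) \<longlonglongrightarrow> 1" if "0 < \<zeta>" for \<zeta>
    using assms(8) t that unfolding hydro_limit_def tailsum_def by blast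
  have tail: "integral {x..1} (\<rho> t) = tail_mass j M x" if "0 < x" "x < 1" for x
    by (rule limit_tail_eq[OF t _ that lim]) (intro indefinite_integral_continuous_1' integrable_continuous_interval cont)
  have "\<rho> t r - rhoM j M r = 0"
  proof (rule continuous_zero_from_tail_integrals[where f = "\<lambda>r. \<rho> t r - rhoM j M r"])
    fix x :: real assume x: "0 < x" "x < 1"
    have "integral {x..1} (\<lambda>r. \<rho> t r - rhoM j M r) = integral {x..1} (\<rho> t) - integral {x..1} (rhoM j M)"
      using x by (intro Henstock_Kurzweil_Integration.integral_diff integrable_continuous_interval
          continuous_on_subset[OF cont] continuous_on_subset[OF cont']) auto
    thus "integral {x..1} (\<lambda>r. \<rho> t r - rhoM j M r) = 0" using x by (simp add: tail integral_rhoM)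
  qed (use r in \<open>auto intro!: continuous_intros cont cont'\<close>)
  thus "\<rho> t r = rhoM j M r" by simp
qed

end
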